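(* Simple $2$-$(55,10,m)$ designs exist for every $m\in\{4,5\}\cup\{8,9,\ldots,M\}$, where $M=443161355=\tfrac12\binom{53}{8}$.
   Context: A $t$-$(v,k,\lambda)$ design consists of a $v$-element set $P$ of points together with a collection $B$ of $k$-element subsets of $P$ (called blocks) such that every $t$-element subset of $P$ is contained in exactly $\lambda$ blocks. The design is simple if $B$ is a set, i.e. contains no repeated blocks. *)

theory Defs
  imports Complex_Main "HOL-Library.Multiset"
begin

text \<open>The collection of blocks is a multiset, so that repeated blocks are possible in a
  design and blocks are counted with multiplicity.\<close>

definition design :: "nat \<Rightarrow> nat \<Rightarrow> nat \<Rightarrow> nat \<Rightarrow> 'a set \<Rightarrow> 'a set multiset \<Rightarrow> bool" where
  "design t v k l P B \<longleftrightarrow>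
     finite P \<and> card P = v \<and>
     (\<forall>b \<in># B. b \<subseteq> P \<and> card b = k) \<and>
     (\<forall>T. T \<subseteq> P \<and> card T = t \<longrightarrow> size {#b \<in># B. T \<subseteq> b#} = l)"

definition simple_design :: "nat \<Rightarrow> nat \<Rightarrow> nat \<Rightarrow> nat \<Rightarrow> 'a set \<Rightarrow> 'a set multiset \<Rightarrow> bool" where
  "simple_design t v k l P B \<longleftrightarrow> design t v k l P B \<and> (\<forall>b \<in># B. count B b = 1)"

end

theory Submission
  imports Defs "HOL-Number_Theory.Number_Theory" "HOL-Library.Code_Binary_Nat"
begin

text \<open>
  Let the points be the residues modulo 53 together with two further points 53 and 54, and let the
  sharply 2-transitive group AGL(1,53) of order 2756 act on the residues and fix 53 and 54. If a
  simple design has all its blocks in pairwise different regular orbits, then its 2756 translates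
  are pairwise disjoint, so any number of them form a simple design again. There are designs with
  \<open>\<lambda> = 4\<close> and \<open>\<lambda> = 5\<close> whose 297 blocks together have this property; their translates give every
  value \<open>4 i + 5 j\<close> with \<open>i, j \<le> 2756\<close>, in particular every residue class modulo 2756. On the other
  hand, for a union of orbits the pair counts depend only on the number of blocks meeting
  \<open>{53, 54}\<close> in a given set: one regular orbit of blocks containing both points, five for each
  choice of exactly one of them and 22 of blocks containing none form a design with \<open>\<lambda> = 2756\<close>.
  More than half of all blocks lie in regular orbits that avoid the 297 special ones, so multiples
  of 2756 can be added up to half of the complete design. Only \<open>\<lambda> = 11\<close> needs a separate example.
\<close>

section \<open>Designs as families of sets\<close>

text \<open>Taking a set of blocks instead of a multiset builds simplicity in, and translates and
  unions of designs become plain images and unions.\<close>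

definition two_design :: "nat set set \<Rightarrow> nat \<Rightarrow> bool" where
  "two_design F l \<longleftrightarrow>
     (\<forall>B\<in>F. B \<subseteq> {..<55} \<and> card B = 10) \<and>
     (\<forall>x<55. \<forall>y<55. x \<noteq> y \<longrightarrow> card {B \<in> F. x \<in> B \<and> y \<in> B} = l)"

lemma finite_family: "(\<And>B. B \<in> F \<Longrightarrow> B \<subseteq> {..<55::nat}) \<Longrightarrow> finite F"
  by (rule finite_subset[of _ "Pow {..<55}"]) auto

lemma two_design_finite: "two_design F l \<Longrightarrow> finite F"
  unfolding two_design_def by (blast intro: finite_family)

lemma two_design_imp_simple_design:
  assumes "two_design F l"
  shows "simple_design 2 55 10 l {..<55} (mset_set F)"
proof -
  have fin: "finite F" using assms by (rule two_design_finite)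
  have "size {#b \<in># mset_set F. T \<subseteq> b#} = l" if T: "T \<subseteq> {..<55}" "card T = 2" for T
  proof -
    obtain x y where "T = {x, y}" "x \<noteq> y" using T(2) by (auto simp: card_2_iff)
    with T(1) assms show ?thesis using fin by (simp add: two_design_def filter_mset_mset_set)
  qed
  with assms fin show ?thesis by (auto simp: simple_design_def design_def two_design_def)
qed

lemma two_design_empty: "two_design {} 0"
  by (simp add: two_design_def)

lemma two_design_Un:
  assumes "two_design F l" "two_design F' l'" "F \<inter> F' = {}"
  shows "two_design (F \<union> F') (l + l')"
proof -
  have fin: "finite F" "finite F'" using assms two_design_finite by auto
  have "card {B \<in> F \<union> F'. x \<in> B \<and> y \<in> B} =
      card {B \<in> F. x \<in> B \<and> y \<in> B} + card {B \<in> F'. x \<in> B \<and> y \<in> B}" for x y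
  proof -
    have eq: "{B \<in> F \<union> F'. x \<in> B \<and> y \<in> B} = {B \<in> F. x \<in> B \<and> y \<in> B} \<union> {B \<in> F'. x \<in> B \<and> y \<in> B}"
      by blast
    show ?thesis unfolding eq using fin assms(3) by (subst card_Un_disjoint) auto
  qed
  with assms show ?thesis unfolding two_design_def by auto
qed

lemma two_design_UN:
  assumes "finite I" "\<And>i. i \<in> I \<Longrightarrow> two_design (F i) l"
    and "\<And>i j. i \<in> I \<Longrightarrow> j \<in> I \<Longrightarrow> i \<noteq> j \<Longrightarrow> F i \<inter> F j = {}"
  shows "two_design (\<Union>i\<in>I. F i) (l * card I)"
  using assms
proof (induction I rule: finite_induct)
  case empty
  then show ?case by (simp add: two_design_empty)
next
  case (insert i I)
  have "two_design (F i \<union> (\<Union>i\<in>I. F i)) (l + l * card I)"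
    using insert by (intro two_design_Un insert.IH) fastforce+
  with insert show ?case by (simp add: add.commute)
qed

lemma two_design_image:
  assumes "two_design F l" "bij_betw f {..<55} {..<55}"
  shows "two_design ((`) f ` F) l"
  unfolding two_design_def
proof (intro conjI ballI allI impI)
  have inj: "inj_on f {..<55}" and surj: "f ` {..<55} = {..<55}"
    using assms(2) by (simp_all add: bij_betw_def)
  have inj': "inj_on ((`) f) F"
    using inj_on_image_Pow[OF inj] by (rule inj_on_subset) (use assms(1) in \<open>auto simp: two_design_def\<close>)
  {
    fix B assume "B \<in> (`) f ` F"
    then obtain C where C: "B = f ` C" "C \<in> F" by blast
    then have C': "C \<subseteq> {..<55}" "card C = 10" using assms(1) by (auto simp: two_design_def)
    show "B \<subseteq> {..<55}" using C C' assms(2) by (auto simp: bij_betw_def)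
    show "card B = 10" using C(1) C'(2) card_image[OF inj_on_subset[OF inj C'(1)]] by simp
  }
  fix x y :: nat assume xy: "x < 55" "y < 55" "x \<noteq> y"
  from xy(1,2) have "x \<in> f ` {..<55}" "y \<in> f ` {..<55}" unfolding surj by simp_all
  then obtain x' y' where x': "x = f x'" "y = f y'" "x' < 55" "y' < 55" by blast
  have "f z \<in> f ` B \<longleftrightarrow> z \<in> B" if "z < 55" "B \<in> F" for z B
    using that assms(1) by (intro inj_on_image_mem_iff[OF inj]) (auto simp: two_design_def)
  then have "{B \<in> (`) f ` F. x \<in> B \<and> y \<in> B} = (`) f ` {B \<in> F. x' \<in> B \<and> y' \<in> B}"
    using x' by auto
  then have "card {B \<in> (`) f ` F. x \<in> B \<and> y \<in> B} = card {B \<in> F. x' \<in> B \<and> y' \<in> B}"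
    using inj' by (simp add: card_image inj_on_def)
  also have "\<dots> = l" using assms(1) x' xy(3) by (auto simp: two_design_def)
  finally show "card {B \<in> (`) f ` F. x \<in> B \<and> y \<in> B} = l" .
qed

text \<open>An injective self-map of a finite family is onto, so \<open>f\<close> permutes the
  blocks and carries those through \<open>x\<close> and \<open>y\<close> bijectively to those
  through \<open>f x\<close> and \<open>f y\<close>. This serves both the affine maps and the shifts
  of order 11.\<close>

lemma pair_count_invariant:
  assumes sub: "\<And>B. B \<in> F \<Longrightarrow> B \<subseteq> {..<55}" and inj: "inj_on f {..<55::nat}"
    and inv: "\<And>B. B \<in> F \<Longrightarrow> f ` B \<in> F" and xy: "x < 55" "y < 55"
  shows "card {B \<in> F. f x \<in> B \<and> f y \<in> B} = card {B \<in> F. x \<in> B \<and> y \<in> B}"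
proof -
  have inj': "inj_on ((`) f) F"
    using inj_on_image_Pow[OF inj] by (rule inj_on_subset) (use sub in auto)
  have surj: "(`) f ` F = F"
    by (rule endo_inj_surj[OF finite_family[OF sub] _ inj']) (use inv in auto)
  have mem: "f z \<in> f ` B \<longleftrightarrow> z \<in> B" if "z < 55" "B \<in> F" for z B
    using that sub by (intro inj_on_image_mem_iff[OF inj]) auto
  have "{B \<in> F. f x \<in> B \<and> f y \<in> B} = {B \<in> (`) f ` F. f x \<in> B \<and> f y \<in> B}"
    using surj by simp
  also have "\<dots> = (`) f ` {B \<in> F. x \<in> B \<and> y \<in> B}"
    using mem xy by auto
  finally show ?thesis using inj' by (simp add: card_image inj_on_def)
qed

lemma sum_card_incidence:
  assumes "finite X" "finite V"
  shows "(\<Sum>x\<in>X. card {B \<in> V. P x B}) = (\<Sum>B\<in>V. card {x \<in> X. P x B})"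
proof -
  have "(\<Sum>x\<in>X. card {B \<in> V. P x B}) = (\<Sum>x\<in>X. \<Sum>B\<in>V. of_bool (P x B))"
    using assms by (simp add: Int_def)
  also have "\<dots> = (\<Sum>B\<in>V. \<Sum>x\<in>X. of_bool (P x B))"
    by (rule sum.swap)
  finally show ?thesis
    using assms by (simp add: Int_def)
qed

section \<open>The affine group\<close>

definition aff :: "nat \<times> nat \<Rightarrow> nat \<Rightarrow> nat" where
  "aff g x = (if x < 53 then (fst g * x + snd g) mod 53 else x)"

definition AGL :: "(nat \<times> nat) set" where
  "AGL = {1..<53} \<times> {..<53}"

lemma prime_53: "prime (53::nat)" "prime (53::int)"
  by simp_all

lemma finite_AGL: "finite AGL" and card_AGL: "card AGL = 2756"
  by (simp_all add: AGL_def)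

lemma aff_less_53: "x < 53 \<Longrightarrow> aff g x < 53"
  and aff_ge_53: "\<not> x < 53 \<Longrightarrow> aff g x = x"
  by (simp_all add: aff_def)

lemma aff_less_53_iff: "aff g x < 53 \<longleftrightarrow> x < 53"
  using aff_less_53[of x g] aff_ge_53[of x g] by (cases "x < 53") auto

lemma aff_less_55: "x < 55 \<Longrightarrow> aff g x < 55"
  using aff_less_53[of x g] aff_ge_53[of x g] by (cases "x < 53") auto

lemma AGL_multiplier_not_dvd:
  assumes "g \<in> AGL" shows "\<not> 53 dvd fst g"
  using assms nat_dvd_not_less by (fastforce simp: AGL_def)

lemma aff_aff:
  assumes "g \<in> AGL" "h \<in> AGL"
  shows "\<exists>k\<in>AGL. \<forall>x. aff g (aff h x) = aff k x"
proof -
  let ?k = "((fst g * fst h) mod 53, (fst g * snd h + snd g) mod 53)"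
  have "\<not> 53 dvd fst g * fst h"
    using assms prime_53 by (simp add: prime_dvd_mult_iff AGL_multiplier_not_dvd del: prime_nat_numeral_eq)
  then have "0 < (fst g * fst h) mod 53" by (simp add: dvd_eq_mod_eq_0)
  then have "?k \<in> AGL" by (simp add: AGL_def)
  moreover have "aff g (aff h x) = aff ?k x" for x
  proof -
    have "[fst g * ((fst h * x + snd h) mod 53) + snd g = fst g * (fst h * x + snd h) + snd g] (mod 53)"
      by (intro cong_add cong_mult cong_refl) (simp add: cong_def)
    also have "fst g * (fst h * x + snd h) + snd g = (fst g * fst h) * x + (fst g * snd h + snd g)"
      by (simp add: algebra_simps)
    also have "[\<dots> = (fst g * fst h) mod 53 * x + (fst g * snd h + snd g) mod 53] (mod 53)"
      by (intro cong_add cong_mult cong_refl) (simp_all add: cong_def)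
    finally show ?thesis by (simp add: aff_def cong_def)
  qed
  ultimately show ?thesis by blast
qed

lemma aff_inverse:
  assumes "g \<in> AGL"
  shows "\<exists>h\<in>AGL. \<forall>x. aff h (aff g x) = x"
proof -
  obtain a b where g: "g = (a, b)" by (cases g)
  have "coprime a 53"
    using AGL_multiplier_not_dvd[OF assms] g prime_53(1)
    by (metis coprime_commute fst_conv prime_imp_coprime)
  then obtain c where c: "[a * c = 1] (mod 53)" by (auto dest: cong_solve_coprime_nat)
  \<comment> \<open>The inverse of x -> a x + b is x -> c (x - b), where -b is replaced by 53 - b to
    stay within the naturals.\<close>
  let ?h = "(c mod 53, (c * (53 - b)) mod 53)"
  have b: "b < 53" using assms g by (simp add: AGL_def)
  have "\<not> 53 dvd c"
  proof
    assume "53 dvd c"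
    then have "53 dvd a * c" by simp
    with c show False by (simp add: cong_def dvd_eq_mod_eq_0)
  qed
  then have "?h \<in> AGL" by (simp add: AGL_def dvd_eq_mod_eq_0)
  moreover have "aff ?h (aff g x) = x" for x
  proof (cases "x < 53")
    case True
    have "[c mod 53 * ((a * x + b) mod 53) + (c * (53 - b)) mod 53 = c * (a * x + b) + c * (53 - b)] (mod 53)"
      by (intro cong_add cong_mult) (simp_all add: cong_def)
    also have "c * (a * x + b) + c * (53 - b) = c * (a * x + (b + (53 - b)))"
      by (simp only: distrib_left add.assoc)
    also have "\<dots> = (a * c) * x + 53 * c"
      using b by (simp add: algebra_simps)
    also have "[\<dots> = 1 * x + 0] (mod 53)"
      using c by (intro cong_add cong_mult cong_refl) (simp_all add: cong_def)
    finally show ?thesis using True g by (simp add: aff_def cong_def)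
  qed (simp add: aff_def)
  ultimately show ?thesis by blast
qed

lemma inj_aff: "g \<in> AGL \<Longrightarrow> inj (aff g)"
proof -
  assume "g \<in> AGL"
  then obtain h where "\<And>x. aff h (aff g x) = x" using aff_inverse by blast
  then show ?thesis by (intro inj_on_inverseI[of _ "aff h"])
qed

lemma aff_image_mem_ge: "\<not> z < 53 \<Longrightarrow> z \<in> aff g ` B \<longleftrightarrow> z \<in> B"
  using aff_less_53_iff[of g] aff_ge_53[of _ g] by (force simp: image_iff)

lemma bij_aff: "g \<in> AGL \<Longrightarrow> bij_betw (aff g) {..<55} {..<55}"
proof -
  assume "g \<in> AGL"
  then have "inj_on (aff g) {..<55}" using inj_aff inj_on_subset by blast
  moreover have "aff g ` {..<55} \<subseteq> {..<55}" using aff_less_55 by blast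
  ultimately show ?thesis by (simp add: bij_betw_def endo_inj_surj)
qed

lemma aff_transitive:
  assumes "x < 53" "y < 53" "x \<noteq> y"
  shows "\<exists>g\<in>AGL. aff g 0 = x \<and> aff g 1 = y"
proof
  \<comment> \<open>The translation part is the image of 0 and the multiplier is y - x; adding 53
    prevents truncated subtraction.\<close>
  let ?g = "((y + 53 - x) mod 53, x)"
  have "(y + 53 - x) mod 53 \<noteq> 0"
  proof
    assume "(y + 53 - x) mod 53 = 0"
    then obtain k where "y + 53 - x = 53 * k" by auto
    with assms show False by (cases k; cases "k - 1") auto
  qed
  with assms show "?g \<in> AGL" by (simp add: AGL_def)
  have "((y + 53 - x) mod 53 + x) mod 53 = (y + 53 - x + x) mod 53" by (rule mod_add_left_eq)
  also have "\<dots> = y" using assms by simp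
  finally show "aff ?g 0 = x \<and> aff ?g 1 = y" using assms by (simp add: aff_def)
qed

section \<open>Orbits of AGL(1,53) and invariant families of blocks\<close>

definition invariant :: "nat set set \<Rightarrow> bool" where
  "invariant F \<longleftrightarrow> (\<forall>g\<in>AGL. \<forall>B\<in>F. aff g ` B \<in> F)"

definition orbit :: "nat set \<Rightarrow> nat set set" where
  "orbit B = (\<lambda>g. aff g ` B) ` AGL"

lemma orbit_self: "B \<in> orbit B"
proof -
  have "(1, 0) \<in> AGL" "aff (1, 0) ` B = B" by (auto simp: AGL_def aff_def image_iff)
  then show ?thesis unfolding orbit_def by blast
qed

lemma invariant_orbit: "invariant (orbit B)"
  unfolding invariant_def orbit_def
proof (intro ballI)
  fix g C assume g: "g \<in> AGL" "C \<in> (\<lambda>g. aff g ` B) ` AGL"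
  then obtain h where h: "h \<in> AGL" "C = aff h ` B" by blast
  obtain k where k: "k \<in> AGL" "\<And>x. aff g (aff h x) = aff k x" using aff_aff[OF g(1) h(1)] by blast
  have "aff g ` C = aff k ` B" using h k(2) by (auto simp: image_image)
  with k(1) show "aff g ` C \<in> (\<lambda>g. aff g ` B) ` AGL" by blast
qed

text \<open>Inverses lie in the group as well, so the complement of an invariant family is also
  preserved. This keeps blocks outside a given orbit outside it.\<close>

lemma invariant_mem_iff:
  assumes "invariant F" "g \<in> AGL"
  shows "aff g ` B \<in> F \<longleftrightarrow> B \<in> F"
proof
  obtain h where h: "h \<in> AGL" "\<And>x. aff h (aff g x) = x" using aff_inverse[OF assms(2)] by blast
  assume "aff g ` B \<in> F"
  then have "aff h ` (aff g ` B) \<in> F" using assms(1) h(1) by (simp add: invariant_def)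
  then show "B \<in> F" using h(2) by (simp add: image_image)
qed (use assms in \<open>simp add: invariant_def\<close>)

text \<open>Double transitivity makes the number of blocks through two residues constant, and double
  counting finds it: each block contains k (k - 1) of the 53 * 52 = 2756 ordered pairs. For a fixed
  point \<open>e\<close>, transitivity on the 53 residues is enough, with k incidences per
  block.\<close>

lemma invariant_pair_counts:
  assumes V: "invariant V" and sub: "\<And>B. B \<in> V \<Longrightarrow> B \<subseteq> {..<55}"
    and k: "\<And>B. B \<in> V \<Longrightarrow> card (B \<inter> {..<53}) = k"
    and card: "card V = n * 2756"
  shows "x < 53 \<Longrightarrow> y < 53 \<Longrightarrow> x \<noteq> y \<Longrightarrow> card {B \<in> V. x \<in> B \<and> y \<in> B} = n * (k * (k - 1))"
    and "x < 53 \<Longrightarrow> e \<in> {53, 54} \<Longrightarrow> (\<And>B. B \<in> V \<Longrightarrow> e \<in> B) \<Longrightarrow>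
      card {B \<in> V. e \<in> B \<and> x \<in> B} = n * (52 * k)"
proof -
  have fin: "finite V" using sub by (rule finite_family)
  have move: "card {B \<in> V. aff g u \<in> B \<and> aff g v \<in> B} = card {B \<in> V. u \<in> B \<and> v \<in> B}"
    if "g \<in> AGL" "u < 55" "v < 55" for g u v
    using pair_count_invariant[of V "aff g" u v] sub that V inj_aff[OF that(1)] inj_on_subset[of "aff g" UNIV]
    by (auto simp: invariant_def)
  {
    assume xy: "x < 53" "y < 53" "x \<noteq> y"
    define c where "c = card {B \<in> V. 0 \<in> B \<and> 1 \<in> B}"
    have c: "card {B \<in> V. u \<in> B \<and> v \<in> B} = c" if "u < 53" "v < 53" "u \<noteq> v" for u v
      using aff_transitive[OF that] move[of _ 0 1] unfolding c_def by auto
    define Z where "Z = (SIGMA u:{..<53::nat}. {..<53} - {u})"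
    have "card Z = 53 * 52" unfolding Z_def by (subst card_SigmaI) auto
    then have "53 * 52 * c = (\<Sum>z\<in>Z. c)" by simp
    also have "\<dots> = (\<Sum>z\<in>Z. card {B \<in> V. fst z \<in> B \<and> snd z \<in> B})"
      by (intro sum.cong c[symmetric]) (auto simp: Z_def)
    also have "\<dots> = (\<Sum>B\<in>V. card {z \<in> Z. fst z \<in> B \<and> snd z \<in> B})"
      using fin by (intro sum_card_incidence) (auto simp: Z_def)
    also have "\<dots> = (\<Sum>B\<in>V. k * (k - 1))"
    proof (rule sum.cong)
      fix B assume B: "B \<in> V"
      have eq: "{z \<in> Z. fst z \<in> B \<and> snd z \<in> B} = (SIGMA u:B \<inter> {..<53}. B \<inter> {..<53} - {u})"
        by (auto simp: Z_def)
      show "card {z \<in> Z. fst z \<in> B \<and> snd z \<in> B} = k * (k - 1)"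
        unfolding eq by (subst card_SigmaI) (use k[OF B] in auto)
    qed simp
    also have "\<dots> = 53 * 52 * (n * (k * (k - 1)))" using card by simp
    finally have "c = n * (k * (k - 1))" by simp
    then show "card {B \<in> V. x \<in> B \<and> y \<in> B} = n * (k * (k - 1))" using c[OF xy] by simp
  }
  {
    assume xe: "x < 53" "e \<in> {53, 54}" "\<And>B. B \<in> V \<Longrightarrow> e \<in> B"
    define c where "c = card {B \<in> V. e \<in> B \<and> 0 \<in> B}"
    have c: "card {B \<in> V. e \<in> B \<and> u \<in> B} = c" if u: "u < 53" for u
    proof -
      \<comment> \<open>The transitivity lemma moves pairs, so an auxiliary second residue is
        supplied for the image of 1.\<close>
      obtain v :: nat where "v < 53" "u \<noteq> v" by (rule that[of "if u = 0 then 1 else 0"]) auto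
      then obtain g where "g \<in> AGL" "aff g 0 = u" using aff_transitive[OF u] by blast
      moreover have "aff g e = e" using xe(2) by (auto simp: aff_def)
      ultimately show ?thesis using move[of g e 0] xe(2) by (auto simp: c_def)
    qed
    have "53 * c = (\<Sum>u\<in>{..<53}. card {B \<in> V. e \<in> B \<and> u \<in> B})" using c by simp
    also have "\<dots> = (\<Sum>B\<in>V. card {u \<in> {..<53}. e \<in> B \<and> u \<in> B})"
      using fin by (intro sum_card_incidence) auto
    also have "\<dots> = (\<Sum>B\<in>V. k)"
    proof (rule sum.cong)
      fix B assume B: "B \<in> V"
      have "{u \<in> {..<53}. e \<in> B \<and> u \<in> B} = B \<inter> {..<53}" using xe(3)[OF B] by blast
      then show "card {u \<in> {..<53}. e \<in> B \<and> u \<in> B} = k" using k[OF B] by simp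
    qed simp
    also have "\<dots> = 53 * (n * (52 * k))" using card by simp
    finally show "card {B \<in> V. e \<in> B \<and> x \<in> B} = n * (52 * k)" using c[OF xe(1)] by simp
  }
qed

section \<open>Moments and regular orbits\<close>

definition psum :: "nat \<Rightarrow> nat set \<Rightarrow> int" where
  "psum j B = (\<Sum>x\<in>B \<inter> {..<53}. int x ^ j)"

text \<open>
  With \<open>k = psum 0 B\<close> and \<open>\<mu>\<close> the mean of the residues in \<open>B\<close>, the next three quantities are
  \<open>k ^ (j - 1) * (\<Sum>x. (x - \<mu>) ^ j)\<close> for \<open>j = 2, 3, 4\<close>. They are therefore invariant under translations
  and homogeneous of degree \<open>j\<close> under scaling.
\<close>

definition moment2 :: "nat set \<Rightarrow> int" where
  "moment2 B = psum 0 B * psum 2 B - psum 1 B ^ 2"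

definition moment3 :: "nat set \<Rightarrow> int" where
  "moment3 B = psum 0 B ^ 2 * psum 3 B - 3 * psum 0 B * psum 1 B * psum 2 B + 2 * psum 1 B ^ 3"

definition moment4 :: "nat set \<Rightarrow> int" where
  "moment4 B = psum 0 B ^ 3 * psum 4 B - 4 * psum 0 B ^ 2 * psum 1 B * psum 3 B
     + 6 * psum 0 B * psum 1 B ^ 2 * psum 2 B - 3 * psum 1 B ^ 4"

lemma psum_0: "psum 0 B = int (card (B \<inter> {..<53}))"
  by (simp add: psum_def)

lemma psum_aff_cong:
  assumes "(a, b) \<in> AGL"
  shows "[psum j (aff (a, b) ` B) = (\<Sum>x\<in>B \<inter> {..<53}. (int a * int x + int b) ^ j)] (mod 53)"
proof -
  have "aff (a, b) ` B \<inter> {..<53} = aff (a, b) ` (B \<inter> {..<53})"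
    by (auto simp: aff_less_53_iff)
  then have "psum j (aff (a, b) ` B) = (\<Sum>x\<in>B \<inter> {..<53}. int (aff (a, b) x) ^ j)"
    unfolding psum_def using inj_on_subset[OF inj_aff[OF assms], of "B \<inter> {..<53}"]
    by (simp add: sum.reindex)
  also have "[\<dots> = (\<Sum>x\<in>B \<inter> {..<53}. (int a * int x + int b) ^ j)] (mod 53)"
    by (intro cong_sum cong_pow) (auto simp: aff_def cong_def zmod_int)
  finally show ?thesis .
qed

lemma psum_aff:
  assumes g: "(a, b) \<in> AGL"
  shows "[psum 0 (aff (a, b) ` B) = psum 0 B] (mod 53)"
    and "[psum 1 (aff (a, b) ` B) = int a * psum 1 B + int b * psum 0 B] (mod 53)"
    and "[psum 2 (aff (a, b) ` B) =
      int a ^ 2 * psum 2 B + 2 * int a * int b * psum 1 B + int b ^ 2 * psum 0 B] (mod 53)"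
    and "[psum 3 (aff (a, b) ` B) = int a ^ 3 * psum 3 B + 3 * int a ^ 2 * int b * psum 2 B
      + 3 * int a * int b ^ 2 * psum 1 B + int b ^ 3 * psum 0 B] (mod 53)"
    and "[psum 4 (aff (a, b) ` B) = int a ^ 4 * psum 4 B + 4 * int a ^ 3 * int b * psum 3 B
      + 6 * int a ^ 2 * int b ^ 2 * psum 2 B + 4 * int a * int b ^ 3 * psum 1 B
      + int b ^ 4 * psum 0 B] (mod 53)"
proof -
  \<comment> \<open>The powers x ^ 0 and x ^ 1 stay visible so that every term of the binomial
    expansion sums to a multiple of some \<open>psum\<close>.\<close>
  have e1: "(int a * x + int b) ^ 1 = int a * x ^ 1 + int b * x ^ 0" for x :: int by simp
  have e2: "(int a * x + int b) ^ 2 = int a ^ 2 * x ^ 2 + 2 * int a * int b * x ^ 1 + int b ^ 2 * x ^ 0"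
    for x :: int unfolding power_one_right power_0 by (simp add: algebra_simps power_numeral_reduce)
  have e3: "(int a * x + int b) ^ 3 = int a ^ 3 * x ^ 3 + 3 * int a ^ 2 * int b * x ^ 2
      + 3 * int a * int b ^ 2 * x ^ 1 + int b ^ 3 * x ^ 0" for x :: int
    unfolding power_one_right power_0 by (simp add: algebra_simps power_numeral_reduce)
  have e4: "(int a * x + int b) ^ 4 = int a ^ 4 * x ^ 4 + 4 * int a ^ 3 * int b * x ^ 3
      + 6 * int a ^ 2 * int b ^ 2 * x ^ 2 + 4 * int a * int b ^ 3 * x ^ 1 + int b ^ 4 * x ^ 0"
    for x :: int unfolding power_one_right power_0 by (simp add: algebra_simps power_numeral_reduce)
  show "[psum 0 (aff (a, b) ` B) = psum 0 B] (mod 53)"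
    using psum_aff_cong[OF g, of 0 B] by (simp add: psum_def)
  show "[psum 1 (aff (a, b) ` B) = int a * psum 1 B + int b * psum 0 B] (mod 53)"
    using psum_aff_cong[OF g, of 1 B] unfolding e1
    by (simp only: psum_def sum.distrib flip: sum_distrib_left)
  show "[psum 2 (aff (a, b) ` B) =
      int a ^ 2 * psum 2 B + 2 * int a * int b * psum 1 B + int b ^ 2 * psum 0 B] (mod 53)"
    using psum_aff_cong[OF g, of 2 B] unfolding e2
    by (simp only: psum_def sum.distrib flip: sum_distrib_left)
  show "[psum 3 (aff (a, b) ` B) = int a ^ 3 * psum 3 B + 3 * int a ^ 2 * int b * psum 2 B
      + 3 * int a * int b ^ 2 * psum 1 B + int b ^ 3 * psum 0 B] (mod 53)"
    using psum_aff_cong[OF g, of 3 B] unfolding e3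
    by (simp only: psum_def sum.distrib flip: sum_distrib_left)
  show "[psum 4 (aff (a, b) ` B) = int a ^ 4 * psum 4 B + 4 * int a ^ 3 * int b * psum 3 B
      + 6 * int a ^ 2 * int b ^ 2 * psum 2 B + 4 * int a * int b ^ 3 * psum 1 B
      + int b ^ 4 * psum 0 B] (mod 53)"
    using psum_aff_cong[OF g, of 4 B] unfolding e4
    by (simp only: psum_def sum.distrib flip: sum_distrib_left)
qed

text \<open>After the transformed power sums are substituted, an integer polynomial identity remains
  in which every term containing \<open>b\<close> cancels.\<close>

lemma moment_aff:
  assumes g: "(a, b) \<in> AGL"
  shows "[moment2 (aff (a, b) ` B) = int a ^ 2 * moment2 B] (mod 53)"
    and "[moment3 (aff (a, b) ` B) = int a ^ 3 * moment3 B] (mod 53)"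
    and "[moment4 (aff (a, b) ` B) = int a ^ 4 * moment4 B] (mod 53)"
proof -
  define k s1 s2 s3 s4 where "k = psum 0 B" and "s1 = psum 1 B" and "s2 = psum 2 B"
    and "s3 = psum 3 B" and "s4 = psum 4 B"
  define t1 t2 t3 t4 where
    "t1 = int a * s1 + int b * k" and
    "t2 = int a ^ 2 * s2 + 2 * int a * int b * s1 + int b ^ 2 * k" and
    "t3 = int a ^ 3 * s3 + 3 * int a ^ 2 * int b * s2 + 3 * int a * int b ^ 2 * s1 + int b ^ 3 * k" and
    "t4 = int a ^ 4 * s4 + 4 * int a ^ 3 * int b * s3 + 6 * int a ^ 2 * int b ^ 2 * s2
      + 4 * int a * int b ^ 3 * s1 + int b ^ 4 * k"
  note s = psum_aff[OF g, of B, folded k_def s1_def s2_def s3_def s4_def, folded t1_def t2_def t3_def t4_def]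
  have "[moment2 (aff (a, b) ` B) = k * t2 - t1 ^ 2] (mod 53)"
    unfolding moment2_def by (intro cong_diff cong_add cong_mult cong_pow cong_refl s)
  also have "k * t2 - t1 ^ 2 = int a ^ 2 * moment2 B"
    unfolding moment2_def t1_def t2_def k_def[symmetric] s1_def[symmetric] s2_def[symmetric] by (simp add: algebra_simps power_numeral_reduce)
  finally show "[moment2 (aff (a, b) ` B) = int a ^ 2 * moment2 B] (mod 53)" .
  have "[moment3 (aff (a, b) ` B) = k ^ 2 * t3 - 3 * k * t1 * t2 + 2 * t1 ^ 3] (mod 53)"
    unfolding moment3_def by (intro cong_diff cong_add cong_mult cong_pow cong_refl s)
  also have "k ^ 2 * t3 - 3 * k * t1 * t2 + 2 * t1 ^ 3 = int a ^ 3 * moment3 B"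
    unfolding moment3_def t1_def t2_def t3_def k_def[symmetric] s1_def[symmetric] s2_def[symmetric]
      s3_def[symmetric] by (simp add: algebra_simps power_numeral_reduce)
  finally show "[moment3 (aff (a, b) ` B) = int a ^ 3 * moment3 B] (mod 53)" .
  have "[moment4 (aff (a, b) ` B) =
      k ^ 3 * t4 - 4 * k ^ 2 * t1 * t3 + 6 * k * t1 ^ 2 * t2 - 3 * t1 ^ 4] (mod 53)"
    unfolding moment4_def by (intro cong_diff cong_add cong_mult cong_pow cong_refl s)
  also have "k ^ 3 * t4 - 4 * k ^ 2 * t1 * t3 + 6 * k * t1 ^ 2 * t2 - 3 * t1 ^ 4 = int a ^ 4 * moment4 B"
    unfolding moment4_def t1_def t2_def t3_def t4_def k_def[symmetric] s1_def[symmetric]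
      s2_def[symmetric] s3_def[symmetric] s4_def[symmetric] by (simp add: algebra_simps power_numeral_reduce)
  finally show "[moment4 (aff (a, b) ` B) = int a ^ 4 * moment4 B] (mod 53)" .
qed

lemma multiplier_not_dvd: "(a, b) \<in> AGL \<Longrightarrow> \<not> (53::int) dvd int a"
  using AGL_multiplier_not_dvd[of "(a, b)"] int_dvd_int_iff[of 53 a] by simp

lemma multiplier_fermat: "(a, b) \<in> AGL \<Longrightarrow> [int a ^ 52 = 1] (mod 53)"
proof -
  assume "(a, b) \<in> AGL"
  then have "[a ^ (53 - 1) = 1] (mod 53)"
    using fermat_theorem[OF prime_53(1), of a] AGL_multiplier_not_dvd[of "(a, b)"] by simp
  then show ?thesis using cong_int_iff[of "a ^ 52" 1 53] by simp
qed

text \<open>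
  A nonzero third moment forces the multiplier of a stabilising affine map to satisfy
  \<open>a ^ 3 = 1\<close>, hence \<open>a = 1\<close> because 3 is coprime to 52.
\<close>

definition skew :: "nat set \<Rightarrow> bool" where
  "skew B \<longleftrightarrow> \<not> 53 dvd moment3 B"

lemma skew_aff_iff:
  assumes "g \<in> AGL"
  shows "skew (aff g ` B) \<longleftrightarrow> skew B"
proof -
  obtain a b where g: "g = (a, b)" by (cases g)
  have "\<not> 53 dvd int a ^ 3"
    using multiplier_not_dvd[of a b] assms g prime_dvd_power[OF prime_53(2)] by blast
  then show ?thesis
    unfolding skew_def using cong_dvd_iff[OF moment_aff(2)[of a b B]] assms g
    by (simp add: prime_dvd_mult_iff[OF prime_53(2)])
qed

text \<open>A skew block has trivial stabiliser: the third moment determines the multiplier, and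
  then \<open>psum 1\<close> determines the translation part, because the number of residues in the
  block is invertible modulo 53.\<close>

lemma aff_image_inject:
  assumes "skew B" "card B = 10" "g \<in> AGL" "h \<in> AGL" "aff g ` B = aff h ` B"
  shows "g = h"
proof -
  obtain a b c d where gh: "g = (a, b)" "h = (c, d)" by (cases g, cases h)
  have bounds: "a < 53" "b < 53" "c < 53" "d < 53" using assms gh by (auto simp: AGL_def)
  have cop: "coprime (moment3 B) 53"
    using assms(1) prime_imp_coprime[OF prime_53(2)] by (auto simp: skew_def coprime_commute)
  have "[int a ^ 3 * moment3 B = int c ^ 3 * moment3 B] (mod 53)"
    using moment_aff(2)[of a b B] moment_aff(2)[of c d B] assms gh cong_trans cong_sym by metis
  then have "[int a ^ 3 = int c ^ 3] (mod 53)"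
    using cong_mult_rcancel[OF cop] by blast
  \<comment> \<open>Since 3 * 35 = 2 * 52 + 1, raising to the power 35 undoes cubing by Fermat's
    theorem.\<close>
  then have cube: "[(int a ^ 3) ^ 35 = (int c ^ 3) ^ 35] (mod 53)"
    by (rule cong_pow)
  have root: "[(int e ^ 3) ^ 35 = int e] (mod 53)" if "(e, f) \<in> AGL" for e f
  proof -
    have "(int e ^ 3) ^ 35 = (int e ^ 52) ^ 2 * int e" by (simp flip: power_mult power_Suc2)
    also have "[\<dots> = 1 ^ 2 * int e] (mod 53)"
      by (intro cong_mult cong_pow cong_refl multiplier_fermat[OF that])
    finally show ?thesis by simp
  qed
  have "[int a = int c] (mod 53)"
    using cube root[of a b] root[of c d] assms gh by (metis cong_sym cong_trans)
  then have ac: "a = c" using bounds by (simp add: cong_def flip: zmod_int)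
  let ?k = "psum 0 B"
  have "[int a * psum 1 B + int b * ?k = int c * psum 1 B + int d * ?k] (mod 53)"
    using psum_aff(2)[of a b B] psum_aff(2)[of c d B] assms gh cong_trans cong_sym by metis
  then have bd: "[int b * ?k = int d * ?k] (mod 53)" using ac by (simp add: cong_add_lcancel)
  have fin: "finite B" using assms(2) card.infinite by fastforce
  \<comment> \<open>A block without residues has zero third moment, so a skew block contains between
    1 and 10 residues.\<close>
  have "moment3 B = 0" if "B \<inter> {..<53} = {}"
    using that by (simp add: moment3_def psum_def)
  then have "0 < card (B \<inter> {..<53})" using assms(1) fin by (auto simp: skew_def card_gt_0_iff)
  moreover have "card (B \<inter> {..<53}) \<le> 10" using assms(2) fin by (metis card_mono inf_le1)
  ultimately have "\<not> 53 dvd ?k" by (auto simp: psum_0 dest: zdvd_imp_le)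
  then have "coprime ?k 53"
    using prime_imp_coprime[OF prime_53(2)] coprime_commute by blast
  then have "[int b = int d] (mod 53)" using bd cong_mult_rcancel by blast
  then have "b = d" using bounds by (simp add: cong_def flip: zmod_int)
  with ac gh show ?thesis by simp
qed

lemma card_orbit: "skew B \<Longrightarrow> card B = 10 \<Longrightarrow> card (orbit B) = 2756"
  unfolding orbit_def using aff_image_inject card_AGL by (subst card_image) (auto simp: inj_on_def)

text \<open>Orbits are added one at a time. The orbit of a block outside the invariant family
  \<open>U\<close> is disjoint from \<open>U\<close>, and skewness gives it exactly 2756
  members.\<close>

lemma exists_invariant_subfamily:
  assumes X: "invariant X" "\<And>B. B \<in> X \<Longrightarrow> skew B \<and> card B = 10" "finite X"
    and "n * 2756 \<le> card X"
  shows "\<exists>U\<subseteq>X. invariant U \<and> card U = n * 2756"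
  using assms(4)
proof (induction n)
  case 0
  show ?case by (intro exI[of _ "{}"]) (simp add: invariant_def)
next
  case (Suc n)
  then obtain U where U: "U \<subseteq> X" "invariant U" "card U = n * 2756" by auto
  have "U \<noteq> X" using Suc.prems U by auto
  then obtain B where B: "B \<in> X" "B \<notin> U" using U by blast
  have "orbit B \<subseteq> X" using X(1) B(1) by (auto simp: orbit_def invariant_def)
  moreover have "orbit B \<inter> U = {}"
    using B(2) invariant_mem_iff[OF U(2)] by (auto simp: orbit_def)
  moreover have "invariant (orbit B \<union> U)"
    using invariant_orbit U(2) by (auto simp: invariant_def)
  moreover have "card (orbit B \<union> U) = Suc n * 2756"
    using calculation(1,2) U X card_orbit[of B] B(1) finite_subset[of _ X]
    by (subst card_Un_disjoint) auto
  ultimately show ?case using U(1) by (intro exI[of _ "orbit B \<union> U"]) auto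
qed

text \<open>
  Non-skew sets are rare: as a function of one of its elements, the third moment of a set is a
  cubic polynomial, so it vanishes for at most three values of that element.
\<close>

lemma cubic_interpolation:
  fixes c0 c1 c2 c3 w x y z :: int
  defines "f \<equiv> \<lambda>t. c3 * t ^ 3 + c2 * t ^ 2 + c1 * t + c0"
  shows "c3 * ((w - x) * (w - y) * (w - z) * (x - y) * (x - z) * (y - z)) =
    f w * ((x - y) * (x - z) * (y - z)) - f x * ((w - y) * (w - z) * (y - z))
    + f y * ((w - x) * (w - z) * (x - z)) - f z * ((w - x) * (w - y) * (x - y))"
  unfolding f_def by (simp add: algebra_simps power_numeral_reduce)

text \<open>Lagrange interpolation at four roots, with denominators cleared, shows that 53 divides
  \<open>c3\<close> times a product of differences of distinct residues, which is impossible for a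
  prime.\<close>

lemma card_cubic_roots:
  fixes c0 c1 c2 c3 :: int
  assumes "\<not> 53 dvd c3"
  shows "card {x \<in> {..<53}. 53 dvd c3 * int x ^ 3 + c2 * int x ^ 2 + c1 * int x + c0} \<le> 3"
proof (rule ccontr)
  define f where "f t = c3 * t ^ 3 + c2 * t ^ 2 + c1 * t + c0" for t
  let ?R = "{x \<in> {..<53::nat}. 53 dvd f (int x)}"
  assume "\<not> ?thesis"
  then have "4 \<le> card ?R" by (simp add: f_def)
  then obtain R where R: "R \<subseteq> ?R" "card R = 4" "finite R" by (rule obtain_subset_with_card_n)
  then obtain w x y z where wxyz: "R = {w, x, y, z}" "distinct [w, x, y, z]"
    by (auto simp: numeral_eq_Suc card_Suc_eq)
  then have roots: "53 dvd f (int w)" "53 dvd f (int x)" "53 dvd f (int y)" "53 dvd f (int z)"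
    and bounds: "w < 53" "x < 53" "y < 53" "z < 53"
    using R(1) by auto
  have diff: "\<not> 53 dvd int u - int v" if "u < 53" "v < 53" "u \<noteq> v" for u v
    using that dvd_imp_le_int[of "int u - int v" 53] by auto
  have "53 dvd c3 * ((int w - int x) * (int w - int y) * (int w - int z)
      * (int x - int y) * (int x - int z) * (int y - int z))"
    unfolding cubic_interpolation[of c3 _ _ _ _ c2 c1 c0, folded f_def]
    by (intro dvd_add dvd_diff dvd_mult2 roots)
  then show False
    using assms diff bounds wxyz(2) by (simp add: prime_dvd_mult_iff[OF prime_53(2)])
qed

lemma card_non_skew_extensions:
  assumes "C \<subseteq> {..<53}" "2 \<le> card C" "card C < 52"
  shows "card {x \<in> {..<53} - C. \<not> skew (insert x C)} \<le> 3"
proof -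
  \<comment> \<open>\<open>?k\<close> is the size of the enlarged set. As a cubic in
    \<open>x\<close>, its third moment has leading coefficient (k - 1)(k - 2), and the bounds on
    \<open>card C\<close> put both factors strictly between 0 and 53.\<close>
  let ?k = "int (card C) + 1" and ?s = "\<lambda>j. psum j C"
  have fin: "finite C" using assms(1) finite_subset by blast
  have *: "moment3 (insert x C) = (?k - 1) * (?k - 2) * int x ^ 3
      + (6 * ?s 1 - 3 * ?k * ?s 1) * int x ^ 2 + (6 * ?s 1 ^ 2 - 3 * ?k * ?s 2) * int x
      + (?k ^ 2 * ?s 3 - 3 * ?k * ?s 1 * ?s 2 + 2 * ?s 1 ^ 3)"
    if "x < 53" "x \<notin> C" for x
  proof -
    have ins: "psum j (insert x C) = int x ^ j + psum j C" for j
      using that fin by (simp add: psum_def)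
    have "psum 0 C = ?k - 1" using assms(1) by (simp add: psum_0 Int_absorb2)
    then show ?thesis unfolding moment3_def ins power_0 power_one_right by (simp add: algebra_simps power_numeral_reduce)
  qed
  have "\<not> 53 dvd (?k - 1) * (?k - 2)"
    using assms(2,3) by (auto simp: prime_dvd_mult_iff[OF prime_53(2)] dest!: zdvd_imp_le)
  note card_cubic_roots[OF this]
  then show ?thesis
    by (rule order.trans[rotated]) (intro card_mono, auto simp: skew_def *)
qed

text \<open>Double counting: removing a chosen element \<open>x\<close> from a non-skew set
  \<open>A\<close> gives a smaller set \<open>C\<close> together with a bad extension
  \<open>x\<close>, the pair (C, x) determines (A, x), and each \<open>C\<close> has at most three
  bad extensions.\<close>

lemma card_non_skew:
  assumes "3 \<le> k" "k \<le> 52"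
  shows "k * card {A. A \<subseteq> {..<53} \<and> card A = k \<and> \<not> skew A} \<le> 3 * (53 choose (k - 1))"
proof -
  let ?Bad = "{A. A \<subseteq> {..<53} \<and> card A = k \<and> \<not> skew A}"
  let ?C = "{C. C \<subseteq> {..<53::nat} \<and> card C = k - 1}"
  let ?T = "SIGMA C:?C. {x \<in> {..<53} - C. \<not> skew (insert x C)}"
  have finC: "finite ?C" by (rule finite_subset[of _ "Pow {..<53}"]) auto
  have finA: "finite A" if "A \<subseteq> {..<53::nat}" for A using that finite_subset by blast
  have "k * card ?Bad = card (SIGMA A:?Bad. A)"
    by (subst card_SigmaI) (auto intro: finA finite_subset[of _ "Pow {..<53}"])
  also have "\<dots> \<le> card ?T"
  proof (rule card_inj_on_le)
    show "inj_on (\<lambda>(A, x). (A - {x}, x)) (SIGMA A:?Bad. A)"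
      by (auto simp: inj_on_def)
    show "(\<lambda>(A, x). (A - {x}, x)) ` (SIGMA A:?Bad. A) \<subseteq> ?T"
      using finA by (auto simp: insert_absorb)
    show "finite ?T" using finC by (intro finite_SigmaI) auto
  qed
  also have "\<dots> = (\<Sum>C\<in>?C. card {x \<in> {..<53} - C. \<not> skew (insert x C)})"
    using finC by (subst card_SigmaI) auto
  also have "\<dots> \<le> (\<Sum>C\<in>?C. 3)"
    using assms by (intro sum_mono card_non_skew_extensions) auto
  also have "\<dots> = 3 * (53 choose (k - 1))"
    using n_subsets[of "{..<53::nat}" "k - 1"] by simp
  finally show ?thesis .
qed

text \<open>The moments ignore 53 and 54, so adjoining \<open>E\<close> preserves skewness and is
  injective on sets of residues.\<close>

lemma card_skew_blocks:
  assumes "E \<subseteq> {53, 54}"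
  shows "card {A. A \<subseteq> {..<53} \<and> card A = 10 - card E \<and> skew A} \<le>
    card {B. B \<subseteq> {..<55} \<and> card B = 10 \<and> B \<inter> {53, 54} = E \<and> skew B}"
proof (rule card_inj_on_le)
  let ?A = "{A. A \<subseteq> {..<53} \<and> card A = 10 - card E \<and> skew A}"
  have E: "finite E" "card E \<le> 2" using assms finite_subset card_mono[of "{53, 54}" E] by auto
  have disj: "A \<inter> E = {}" if "A \<subseteq> {..<53}" for A using that assms by fastforce
  show "inj_on (\<lambda>A. A \<union> E) ?A"
    using disj by (intro inj_onI) blast
  have "skew (A \<union> E) \<longleftrightarrow> skew A" if "A \<subseteq> {..<53}" for A
  proof -
    have "(A \<union> E) \<inter> {..<53} = A \<inter> {..<53}" using assms by auto
    then have "psum j (A \<union> E) = psum j A" for j by (simp add: psum_def)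
    then show ?thesis by (simp add: skew_def moment3_def)
  qed
  moreover have "card (A \<union> E) = 10" if "A \<subseteq> {..<53}" "card A = 10 - card E" for A
    using that disj E finite_subset[OF that(1)] by (subst card_Un_disjoint) auto
  moreover have "(A \<union> E) \<inter> {53, 54} = E" if "A \<subseteq> {..<53}" for A using that assms by auto
  moreover have "A \<subseteq> {..<55}" if "A \<subseteq> {..<53}" for A :: "nat set" using that by auto
  moreover have "E \<subseteq> {..<55}" using assms by auto
  ultimately show "(\<lambda>A. A \<union> E) ` ?A \<subseteq> {B. B \<subseteq> {..<55} \<and> card B = 10 \<and> B \<inter> {53, 54} = E \<and> skew B}"
    by auto
  show "finite {B. B \<subseteq> {..<55} \<and> card B = 10 \<and> B \<inter> {53, 54} = E \<and> skew B}"
    by (rule finite_family) auto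
qed

section \<open>Combining orbits and translates\<close>

text \<open>Among the blocks of type \<open>E\<close>, discard the non-skew ones and at most 300
  orbits of at most 2756 blocks each. What is left is invariant, and by the numerical hypothesis
  large enough to take \<open>n\<close> whole regular orbits from it.\<close>

lemma exists_invariant_blocks:
  assumes E: "E \<subseteq> {53, 54}" and Ds: "finite Ds" "card Ds \<le> 300"
    and n: "n * 2756 + 300 * 2756 + 3 * (53 choose (9 - card E)) div (10 - card E) \<le> (53 choose (10 - card E))"
  shows "\<exists>U. invariant U \<and> card U = n * 2756 \<and>
    (\<forall>B\<in>U. B \<subseteq> {..<55} \<and> card B = 10 \<and> B \<inter> {53, 54} = E \<and> (\<forall>D\<in>Ds. B \<notin> orbit D))"
proof -
  let ?k = "10 - card E"
  let ?S = "{B. B \<subseteq> {..<55} \<and> card B = 10 \<and> B \<inter> {53, 54} = E \<and> skew B}"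
  let ?O = "\<Union>D\<in>Ds. orbit D"
  define X where "X = ?S - ?O"
  have k: "3 \<le> ?k" "?k \<le> 52" "?k - 1 = 9 - card E" using card_mono[OF _ E] by auto
  have "card {A. A \<subseteq> {..<53} \<and> card A = ?k \<and> \<not> skew A} \<le> 3 * (53 choose (9 - card E)) div ?k"
    using card_non_skew[OF k(1,2)] k by (simp add: less_eq_div_iff_mult_less_eq mult.commute)
  moreover have "(53 choose ?k) = card {A. A \<subseteq> {..<53} \<and> card A = ?k \<and> skew A}
      + card {A. A \<subseteq> {..<53} \<and> card A = ?k \<and> \<not> skew A}"
  proof -
    have fin: "finite {A. A \<subseteq> {..<53::nat} \<and> card A = ?k \<and> P A}" for P
      by (rule finite_subset[of _ "Pow {..<53}"]) auto
    have "{A. A \<subseteq> {..<53::nat} \<and> card A = ?k} = {A. A \<subseteq> {..<53} \<and> card A = ?k \<and> skew A}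
        \<union> {A. A \<subseteq> {..<53} \<and> card A = ?k \<and> \<not> skew A}" by blast
    then show ?thesis
      using n_subsets[of "{..<53::nat}" ?k] card_Un_disjoint[OF fin[of skew] fin[of "\<lambda>A. \<not> skew A"]] by auto
  qed
  moreover have "card ?O \<le> 300 * 2756"
  proof -
    have "card ?O \<le> (\<Sum>D\<in>Ds. card (orbit D))" using Ds(1) by (rule card_UN_le)
    also have "\<dots> \<le> (\<Sum>D\<in>Ds. 2756)"
      unfolding orbit_def
      by (intro sum_mono order.trans[OF card_image_le[OF finite_AGL]]) (simp add: card_AGL)
    finally show ?thesis using Ds(2) by simp
  qed
  moreover have "card ?S - card ?O \<le> card X"
    unfolding X_def using Ds(1) finite_AGL by (intro diff_card_le_card_Diff) (auto simp: orbit_def)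
  ultimately have card: "n * 2756 \<le> card X"
    using n card_skew_blocks[OF E] by linarith
  have "invariant X"
    unfolding invariant_def
  proof (intro ballI)
    fix g B assume g: "g \<in> AGL" and B: "B \<in> X"
    have "aff g ` B \<subseteq> {..<55}" using B aff_less_55[of _ g] by (auto simp: X_def)
    moreover have "card (aff g ` B) = 10"
      using B card_image[OF inj_on_subset[OF inj_aff[OF g]]] by (auto simp: X_def)
    moreover have "aff g ` B \<inter> {53, 54} = B \<inter> {53, 54}"
      using aff_image_mem_ge[of 53 g B] aff_image_mem_ge[of 54 g B] by auto
    moreover have "aff g ` B \<notin> orbit D" if "D \<in> Ds" for D
      using B that invariant_mem_iff[OF invariant_orbit g] by (auto simp: X_def)
    ultimately show "aff g ` B \<in> X" using B skew_aff_iff[OF g] by (auto simp: X_def)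
  qed
  moreover have "skew B \<and> card B = 10" if "B \<in> X" for B using that by (simp add: X_def)
  moreover have "finite X" by (rule finite_family) (auto simp: X_def)
  ultimately obtain U where "U \<subseteq> X" "invariant U" "card U = n * 2756"
    using exists_invariant_subfamily[OF _ _ _ card] by blast
  then show ?thesis by (intro exI[of _ U]) (auto simp: X_def)
qed

text \<open>The bound 160799 is the quotient of 443161355 by 2756.\<close>

lemma exists_large_design:
  assumes Ds: "finite Ds" "card Ds \<le> 300" and q: "q \<le> 160799"
  shows "\<exists>U. two_design U (2756 * q) \<and> (\<forall>B\<in>U. \<forall>D\<in>Ds. B \<notin> orbit D)"
proof -
  have binom: "53 choose 7 = 154143080" "53 choose 8 = 886322710" "53 choose 9 = 4431613550"
    "53 choose 10 = 19499099620"
    by code_simp+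
  define good where "good E U \<longleftrightarrow> invariant U \<and>
    (\<forall>B\<in>U. B \<subseteq> {..<55} \<and> card B = 10 \<and> B \<inter> {53, 54} = E \<and> (\<forall>D\<in>Ds. B \<notin> orbit D))" for E U
  \<comment> \<open>The multiplicities 1, 5, 5, 22 balance all pair counts. The pair 53, 54 occurs
    only in the first type; a fixed point and a residue give 52 * (8 + 5 * 9) = 2756; two residues
    give 8 * 7 + 2 * 5 * 9 * 8 + 22 * 10 * 9 = 2756.\<close>
  have "\<exists>U. good {53, 54} U \<and> card U = q * 2756"
    using exists_invariant_blocks[OF _ Ds, of "{53, 54}" q] q binom unfolding good_def by auto
  moreover have "\<exists>U. good {53} U \<and> card U = (5 * q) * 2756" "\<exists>U. good {54} U \<and> card U = (5 * q) * 2756"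
    using exists_invariant_blocks[OF _ Ds, of "{53}" "5 * q"]
      exists_invariant_blocks[OF _ Ds, of "{54}" "5 * q"] q binom unfolding good_def by auto
  moreover have "\<exists>U. good {} U \<and> card U = (22 * q) * 2756"
    using exists_invariant_blocks[OF _ Ds, of "{}" "22 * q"] q binom unfolding good_def by auto
  ultimately obtain U1 U2 U3 U4 where U: "good {53, 54} U1" "good {53} U2" "good {54} U3" "good {} U4"
    and cards: "card U1 = q * 2756" "card U2 = (5 * q) * 2756" "card U3 = (5 * q) * 2756"
      "card U4 = (22 * q) * 2756"
    by blast
  let ?U = "U1 \<union> U2 \<union> U3 \<union> U4"
  have fin: "finite U1" "finite U2" "finite U3" "finite U4"
    using U by (auto simp: good_def intro!: finite_family)
  have core: "card (B \<inter> {..<53}) = 10 - card E" if "good E V" "B \<in> V" for E V B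
  proof -
    have B: "B \<subseteq> {..<55}" "card B = 10" "B \<inter> {53, 54} = E" using that by (auto simp: good_def)
    have "x < 53 \<longleftrightarrow> x \<notin> {53, 54}" if "x \<in> B" for x
    proof -
      have "x < 55" using that B(1) by blast
      then show ?thesis by auto
    qed
    then have "B \<inter> {..<53} = B - E" using B(3) by blast
    moreover have "E \<subseteq> B" "finite E" using B(3) by auto
    ultimately show ?thesis using B(2) by (simp add: card_Diff_subset)
  qed
  have mem: "(53 \<in> B) = (53 \<in> E)" "(54 \<in> B) = (54 \<in> E)" if "good E V" "B \<in> V" for E V B
    using that by (auto simp: good_def)
  have disj: "V \<inter> V' = {}" if "good E V" "good E' V'" "E \<noteq> E'" for E E' V V'
    using that by (auto simp: good_def)
  have "{53::nat} \<noteq> {54}" "{53::nat, 54} \<noteq> {53}" "{53::nat, 54} \<noteq> {54}" by auto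
  with U disj have disj: "U1 \<inter> U2 = {}" "U1 \<inter> U3 = {}" "U1 \<inter> U4 = {}" "U2 \<inter> U3 = {}"
    "U2 \<inter> U4 = {}" "U3 \<inter> U4 = {}" by (metis insert_not_empty)+
  have split: "card {B \<in> ?U. P B} = card {B \<in> U1. P B} + card {B \<in> U2. P B} + card {B \<in> U3. P B}
      + card {B \<in> U4. P B}" for P
  proof -
    have eq: "{B \<in> ?U. P B} = {B \<in> U1. P B} \<union> {B \<in> U2. P B} \<union> {B \<in> U3. P B} \<union> {B \<in> U4. P B}" by blast
    show ?thesis
      unfolding eq using fin disj by (simp add: card_Un_disjoint Int_Un_distrib2 disjoint_iff)
  qed
  have finite_pairs: "card {B \<in> V. x \<in> B \<and> y \<in> B} = n * ((10 - card E) * (10 - card E - 1))"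
    if "good E V" "card V = n * 2756" "x < 53" "y < 53" "x \<noteq> y" for E V n x y
    using invariant_pair_counts(1)[of V "10 - card E" n x y] core[OF that(1)] that by (auto simp: good_def)
  have infinite_pairs: "card {B \<in> V. e \<in> B \<and> x \<in> B} = (if e \<in> E then n * (52 * (10 - card E)) else 0)"
    if "good E V" "card V = n * 2756" "x < 53" "e \<in> {53, 54}" for E V n x e
  proof (cases "e \<in> E")
    case True
    then show ?thesis
      using invariant_pair_counts(2)[of V "10 - card E" n x e] core[OF that(1)] mem[OF that(1)] that
      by (auto simp: good_def)
  next
    case False
    then have none: "{B \<in> V. e \<in> B \<and> x \<in> B} = {}" using mem[OF that(1)] that(4) by auto
    show ?thesis unfolding none using False by simp
  qed
  have pairs: "card {B \<in> ?U. x \<in> B \<and> y \<in> B} = 2756 * q" if "x < y" "y < 55" for x y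
  proof -
    consider "y < 53" | "x < 53" "y \<in> {53, 54}" | "x = 53" "y = 54" using \<open>x < y\<close> \<open>y < 55\<close> by fastforce
    then show ?thesis
    proof cases
      case 1
      then show ?thesis
        unfolding split using that U cards by (simp add: finite_pairs)
    next
      case 2
      have comm: "{B \<in> V. x \<in> B \<and> y \<in> B} = {B \<in> V. y \<in> B \<and> x \<in> B}" for V :: "nat set set" by blast
      show ?thesis
        unfolding split comm infinite_pairs[OF U(1) cards(1) 2] infinite_pairs[OF U(2) cards(2) 2]
          infinite_pairs[OF U(3) cards(3) 2] infinite_pairs[OF U(4) cards(4) 2]
        using 2(2) by auto
    next
      case 3
      have types: "{B \<in> U1. x \<in> B \<and> y \<in> B} = U1" "{B \<in> U2. x \<in> B \<and> y \<in> B} = {}"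
        "{B \<in> U3. x \<in> B \<and> y \<in> B} = {}" "{B \<in> U4. x \<in> B \<and> y \<in> B} = {}"
        using 3 mem[OF U(1)] mem[OF U(2)] mem[OF U(3)] mem[OF U(4)] by auto
      show ?thesis unfolding split types using cards by simp
    qed
  qed
  have "card {B \<in> ?U. x \<in> B \<and> y \<in> B} = 2756 * q" if "x < 55" "y < 55" "x \<noteq> y" for x y
  proof (cases "x < y")
    case False
    have comm: "{B \<in> ?U. x \<in> B \<and> y \<in> B} = {B \<in> ?U. y \<in> B \<and> x \<in> B}" by blast
    show ?thesis unfolding comm by (rule pairs) (use that False in auto)
  qed (use pairs that in blast)
  moreover have blocks: "B \<subseteq> {..<55} \<and> card B = 10 \<and> (\<forall>D\<in>Ds. B \<notin> orbit D)" if "B \<in> ?U" for B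
    using that U by (elim UnE) (simp_all add: good_def)
  ultimately have "two_design ?U (2756 * q)"
    unfolding two_design_def by simp
  with blocks show ?thesis by (intro exI[of _ ?U] conjI) simp_all
qed

text \<open>
  The exponents make the total degree in the multiplier \<open>a\<close> a multiple of 52.
\<close>

definition invariants :: "nat set \<Rightarrow> bool \<times> bool \<times> int \<times> int" where
  "invariants B = (53 \<in> B, 54 \<in> B, moment2 B * moment3 B ^ 34 mod 53, moment4 B * moment3 B ^ 16 mod 53)"

lemma invariants_aff:
  assumes "g \<in> AGL"
  shows "invariants (aff g ` B) = invariants B"
proof -
  obtain a b where g: "g = (a, b)" "(a, b) \<in> AGL" using assms by (cases g) auto
  note f = multiplier_fermat[OF g(2)]
  have "[moment2 (aff g ` B) * moment3 (aff g ` B) ^ 34 = (int a ^ 2 * moment2 B) * (int a ^ 3 * moment3 B) ^ 34] (mod 53)"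
    unfolding g(1) by (intro cong_mult cong_pow moment_aff g(2))
  also have "(int a ^ 2 * moment2 B) * (int a ^ 3 * moment3 B) ^ 34 = (int a ^ 52) ^ 2 * (moment2 B * moment3 B ^ 34)"
    by (simp add: power_mult_distrib flip: power_mult power_add)
  also have "[\<dots> = 1 ^ 2 * (moment2 B * moment3 B ^ 34)] (mod 53)"
    by (intro cong_mult cong_pow cong_refl f)
  finally have 1: "[moment2 (aff g ` B) * moment3 (aff g ` B) ^ 34 = moment2 B * moment3 B ^ 34] (mod 53)"
    by simp
  have "[moment4 (aff g ` B) * moment3 (aff g ` B) ^ 16 = (int a ^ 4 * moment4 B) * (int a ^ 3 * moment3 B) ^ 16] (mod 53)"
    unfolding g(1) by (intro cong_mult cong_pow moment_aff g(2))
  also have "(int a ^ 4 * moment4 B) * (int a ^ 3 * moment3 B) ^ 16 = int a ^ 52 * (moment4 B * moment3 B ^ 16)"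
    by (simp add: power_mult_distrib flip: power_mult power_add)
  also have "[\<dots> = 1 * (moment4 B * moment3 B ^ 16)] (mod 53)"
    by (intro cong_mult cong_pow cong_refl f)
  finally have 2: "[moment4 (aff g ` B) * moment3 (aff g ` B) ^ 16 = moment4 B * moment3 B ^ 16] (mod 53)"
    by simp
  show ?thesis
    using 1 2 aff_image_mem_ge[of 53 g B] aff_image_mem_ge[of 54 g B]
    by (simp add: invariants_def cong_def)
qed

lemma exists_design:
  assumes D: "two_design D4 4" "two_design D5 5" "D4 \<inter> D5 = {}" "card (D4 \<union> D5) \<le> 300"
    and skew: "\<And>B. B \<in> D4 \<union> D5 \<Longrightarrow> skew B" and inj: "inj_on invariants (D4 \<union> D5)"
    and bounds: "i \<le> 2756" "j \<le> 2756" "q \<le> 160799"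
  shows "\<exists>F. two_design F (4 * i + 5 * j + 2756 * q)"
proof -
  obtain I where I: "I \<subseteq> AGL" "card I = i" "finite I"
    using bounds(1) card_AGL obtain_subset_with_card_n by metis
  obtain J where J: "J \<subseteq> AGL" "card J = j" "finite J"
    using bounds(2) card_AGL obtain_subset_with_card_n by metis
  have fin: "finite (D4 \<union> D5)" using D two_design_finite by blast
  obtain U where U: "two_design U (2756 * q)" "\<And>B D. B \<in> U \<Longrightarrow> D \<in> D4 \<union> D5 \<Longrightarrow> B \<notin> orbit D"
    using exists_large_design[OF fin D(4) bounds(3)] by blast
  \<comment> \<open>The invariants identify the block and the trivial stabiliser identifies the
    group element, so a translated block determines both. All disjointness claims among the
    translates rest on this.\<close>
  have same: "B = C \<and> g = h"
    if "B \<in> D4 \<union> D5" "C \<in> D4 \<union> D5" "g \<in> AGL" "h \<in> AGL" "aff g ` B = aff h ` C" for B C g h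
  proof -
    have "invariants B = invariants C"
      using invariants_aff[OF that(3), of B] invariants_aff[OF that(4), of C] that(5) by simp
    then have "B = C" using inj that by (auto dest: inj_onD)
    moreover have "card B = 10" using D(1,2) that(1) by (auto simp: two_design_def)
    ultimately show ?thesis using aff_image_inject skew that by blast
  qed
  let ?T = "\<lambda>D g. (`) (aff g) ` D"
  have translates: "two_design (\<Union>g\<in>K. ?T D g) (l * card K)"
    if K: "two_design D l" "D \<subseteq> D4 \<union> D5" "K \<subseteq> AGL" for D l K
  proof (rule two_design_UN)
    show "finite K" using K(3) finite_AGL finite_subset by blast
    show "two_design (?T D g) l" if "g \<in> K" for g
      using two_design_image[OF K(1) bij_aff] that K(3) by blast
    show "?T D g \<inter> ?T D h = {}" if gh: "g \<in> K" "h \<in> K" "g \<noteq> h" for g h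
    proof (rule equals0I)
      fix X assume "X \<in> ?T D g \<inter> ?T D h"
      then obtain B C where "B \<in> D" "C \<in> D" "aff g ` B = aff h ` C" by blast
      then show False using same[of B C g h] gh K(2,3) by blast
    qed
  qed
  have F: "two_design ((\<Union>g\<in>I. ?T D4 g) \<union> (\<Union>g\<in>J. ?T D5 g)) (4 * card I + 5 * card J)"
  proof (rule two_design_Un)
    show "(\<Union>g\<in>I. ?T D4 g) \<inter> (\<Union>g\<in>J. ?T D5 g) = {}"
    proof (rule equals0I)
      fix X assume "X \<in> (\<Union>g\<in>I. ?T D4 g) \<inter> (\<Union>g\<in>J. ?T D5 g)"
      then obtain B C g h where "B \<in> D4" "C \<in> D5" "g \<in> I" "h \<in> J" "aff g ` B = aff h ` C" by blast
      then show False using same[of B C g h] D(3) I(1) J(1) by blast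
    qed
  qed (use translates D(1,2) I(1) J(1) in simp_all)
  have disj: "((\<Union>g\<in>I. ?T D4 g) \<union> (\<Union>g\<in>J. ?T D5 g)) \<inter> U = {}"
  proof (rule equals0I)
    fix X assume X: "X \<in> ((\<Union>g\<in>I. ?T D4 g) \<union> (\<Union>g\<in>J. ?T D5 g)) \<inter> U"
    then obtain g B where "g \<in> AGL" "B \<in> D4 \<union> D5" "X = aff g ` B" using I(1) J(1) by blast
    then show False using U(2)[of X B] X by (auto simp: orbit_def)
  qed
  from two_design_Un[OF F U(1) disj] show ?thesis unfolding I(2) J(2) by (rule exI)
qed

section \<open>Checking the explicit designs\<close>

text \<open>
  The points form five copies of the integers modulo 11, and \<open>shift 1\<close> translates the \<open>i\<close>-th copy by
  \<open>i + 1\<close>. A common translation of all copies would agree with a translation modulo 53 on every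
  block without wrap-around, so that blocks of one design would share an orbit of AGL(1,53).
\<close>

definition shift :: "nat \<Rightarrow> nat \<Rightarrow> nat" where
  "shift j x = 11 * (x div 11) + (x + j * (x div 11 + 1)) mod 11"

definition shifts :: "nat list \<Rightarrow> nat list list" where
  "shifts b = map (\<lambda>j. map (shift j) b) [0..<11]"

definition develop :: "nat list list \<Rightarrow> nat list list" where
  "develop bs = concat (map shifts bs)"

definition valid_blocks :: "nat list list \<Rightarrow> bool" where
  "valid_blocks bs \<longleftrightarrow> list_all (\<lambda>b. distinct b \<and> length b = 10 \<and> list_all (\<lambda>x. x < 55) b) bs"

text \<open>
  Symbolic evaluation takes time quadratic in the length of a list, so the following checks keep
  their data in lists of short lists and split them by binary search.
\<close>

definition neighbours :: "nat \<Rightarrow> nat list list \<Rightarrow> nat list" where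
  "neighbours i Ds = filter (\<lambda>y. y \<noteq> i) (concat (filter (\<lambda>b. i \<in> set b) Ds))"

text \<open>Bisection of the interval of length \<open>2 ^ d\<close> starting at \<open>a\<close>;
  at a leaf all remaining entries have to be the single value \<open>a\<close>.\<close>

primrec uniform :: "nat \<Rightarrow> nat \<Rightarrow> nat \<Rightarrow> nat list list \<Rightarrow> bool" where
  "uniform l 0 a xss \<longleftrightarrow> concat xss = replicate l a"
| "uniform l (Suc d) a xss \<longleftrightarrow>
     uniform l d a (map (filter (\<lambda>x. x < a + 2 ^ d)) xss) \<and>
     uniform l d (a + 2 ^ d) (map (filter (\<lambda>x. \<not> x < a + 2 ^ d)) xss)"

text \<open>
  The values \<open>i\<close> and \<open>55, \<dots>, 63\<close>, which are not neighbours of \<open>i\<close>, are padded so that all of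
  \<open>0, \<dots>, 63\<close> must occur equally often.
\<close>

definition balanced_at :: "nat \<Rightarrow> nat list list list \<Rightarrow> nat \<Rightarrow> bool" where
  "balanced_at l Dss i \<longleftrightarrow>
     uniform l 6 0 (map (replicate l) (i # [55..<64]) @ map (neighbours i) Dss)"

text \<open>The five copies are the point orbits of the shifts, so one point of each copy is
  tested.\<close>

definition balanced :: "nat \<Rightarrow> nat list list \<Rightarrow> bool" where
  "balanced l bs \<longleftrightarrow> list_all (balanced_at l (map shifts bs)) [0, 11, 22, 33, 44]"

definition sq53 :: "int \<Rightarrow> int" where
  "sq53 x = x * x mod 53"

text \<open>The value 0 is reserved for blocks that are not skew.\<close>

definition key :: "nat list \<Rightarrow> nat" where
  "key b =
    (let c = map int (filter (\<lambda>x. x < 53) b);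
         k = int (length c);
         s1 = sum_list c mod 53;
         s2 = sum_list (map (\<lambda>x. x ^ 2) c) mod 53;
         s3 = sum_list (map (\<lambda>x. x ^ 3) c) mod 53;
         s4 = sum_list (map (\<lambda>x. x ^ 4) c) mod 53;
         m2 = (k * s2 - s1 ^ 2) mod 53;
         m3 = (k ^ 2 * s3 - 3 * k * s1 * s2 + 2 * s1 ^ 3) mod 53;
         m4 = (k ^ 3 * s4 - 4 * k ^ 2 * s1 * s3 + 6 * k * s1 ^ 2 * s2 - 3 * s1 ^ 4) mod 53;
         e = sq53 (sq53 (sq53 (sq53 m3)))
     in if m3 = 0 then 0
        else nat (1 + 53 * (53 * (of_bool (53 \<in> set b) + 2 * of_bool (54 \<in> set b))
          + m2 * sq53 m3 * sq53 e mod 53) + m4 * e mod 53))"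

text \<open>A binary trie on the low bits: \<open>tl xs = []\<close> says that at most one entry is
  left. Equal entries are never separated and make the test fail at depth 0.\<close>

primrec spread :: "nat \<Rightarrow> nat list \<Rightarrow> bool" where
  "spread 0 xs \<longleftrightarrow> tl xs = []"
| "spread (Suc d) xs \<longleftrightarrow>
     (if tl xs = [] then True
      else spread d (map (\<lambda>x. x div 2) (filter even xs)) \<and> spread d (map (\<lambda>x. x div 2) (filter odd xs)))"

text \<open>A cheap fingerprint of a block as a set: different sums certify different blocks in the
  design with lambda = 11.\<close>

definition cube_sum :: "nat list \<Rightarrow> nat" where
  "cube_sum b = sum_list (map (\<lambda>x. x ^ 3) b)"

section \<open>Correctness of the computational checks\<close>

lemma shift_shift: "shift i (shift j x) = shift (i + j) x"
proof -
  have "shift j x div 11 = x div 11" by (simp add: shift_def)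
  moreover have "shift j x mod 11 = (x + j * (x div 11 + 1)) mod 11" by (simp add: shift_def)
  ultimately have "shift i (shift j x) =
      11 * (x div 11) + ((x + j * (x div 11 + 1)) mod 11 + i * (x div 11 + 1)) mod 11"
    unfolding shift_def[of i] by (metis mod_add_left_eq)
  also have "\<dots> = 11 * (x div 11) + ((x + j * (x div 11 + 1)) + i * (x div 11 + 1)) mod 11"
    by (simp only: mod_add_left_eq)
  also have "\<dots> = shift (i + j) x"
    by (simp add: shift_def algebra_simps)
  finally show ?thesis .
qed

lemma shift_mod: "shift (j mod 11) x = shift j x"
proof -
  have "(x + (j mod 11) * (x div 11 + 1)) mod 11 = (x + j * (x div 11 + 1)) mod 11"
    by (metis mod_add_right_eq mod_mult_left_eq)
  then show ?thesis by (simp add: shift_def)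
qed

lemma shift_0: "shift 0 x = x"
  by (simp add: shift_def)

lemma shift_less: "x < 55 \<Longrightarrow> shift j x < 55"
proof -
  assume "x < 55"
  then have "x div 11 \<le> 4" by auto
  moreover have "(x + j * (x div 11 + 1)) mod 11 < 11" by simp
  ultimately show ?thesis unfolding shift_def by linarith
qed

lemma inj_shift: "inj (shift j)"
proof (rule inj_on_inverseI)
  fix x
  \<comment> \<open>The composition is \<open>shift (11 * j)\<close>, which equals
    \<open>shift 0\<close> because shifts have period 11.\<close>
  show "shift (10 * j) (shift j x) = x"
    using shift_mod[of "11 * j" x] by (simp add: shift_shift shift_0)
qed

lemma shift_representative: "\<exists>i\<in>{0, 11, 22, 33, 44}. \<exists>j. shift j i = x" if "x < 55"
proof -
  have "list_all (\<lambda>x. list_ex (\<lambda>i. list_ex (\<lambda>j. shift j i = x) [0..<11]) [0, 11, 22, 33, 44]) [0..<55]"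
    by code_simp
  then have "\<forall>x\<in>set [0..<55]. \<exists>i\<in>set [0, 11, 22, 33, 44]. \<exists>j\<in>set [0..<11]. shift j i = x"
    by (simp only: list_all_iff list_ex_iff)
  moreover have "x \<in> set [0..<55]" using that by (simp only: set_upt atLeastLessThan_iff) simp
  ultimately have "\<exists>i\<in>set [0, 11, 22, 33, 44]. \<exists>j\<in>set [0..<11]. shift j i = x" by (rule bspec)
  then show ?thesis unfolding list.set by blast
qed

text \<open>Periodicity allows all \<open>j\<close> in place of \<open>[0..<11]\<close>, which makes
  closure under shifts immediate.\<close>

lemma set_develop:
  "set ` set (develop bs) = (\<Union>b\<in>set bs. range (\<lambda>j. shift j ` set b))"
proof -
  have "range (\<lambda>j. shift j ` A) = (\<lambda>j. shift j ` A) ` {0..<11}" for A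
  proof -
    have "shift j ` A = shift (j mod 11) ` A" "j mod 11 \<in> {0..<11}" for j by (simp_all add: shift_mod)
    then show ?thesis by blast
  qed
  then show ?thesis by (simp add: develop_def shifts_def image_UN image_image)
qed

lemma develop_block:
  assumes "valid_blocks bs" "b \<in> set (develop bs)"
  shows "distinct b" "set b \<subseteq> {..<55}" "card (set b) = 10"
proof -
  obtain c j where c: "c \<in> set bs" "b = map (shift j) c" using assms(2) by (auto simp: develop_def shifts_def)
  then have c': "distinct c" "length c = 10" "\<forall>x\<in>set c. x < 55"
    using assms(1) by (auto simp: valid_blocks_def list_all_iff)
  then show b: "distinct b" "set b \<subseteq> {..<55}"
    using c(2) inj_on_subset[OF inj_shift] shift_less by (auto simp: distinct_map)
  then show "card (set b) = 10" using c(2) c'(2) by (simp add: distinct_card del: set_map)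
qed

lemma uniform_count:
  "uniform l d a xss \<Longrightarrow> a \<le> y \<Longrightarrow> y < a + 2 ^ d \<Longrightarrow> count_list (concat xss) y = l"
proof (induction d arbitrary: a xss)
  case 0
  have "count_list (replicate n a) a = n" for n by (induction n) auto
  moreover have "y = a" using 0 by simp
  ultimately show ?case using 0 by simp
next
  case (Suc d)
  have "count_list (filter P xs) y = count_list xs y" if "P y" for P xs
    using that by (induction xs) auto
  then have filter: "count_list (concat (map (filter P) xss)) y = count_list (concat xss) y" if "P y" for P
    using that by (induction xss) auto
  show ?case
  proof (cases "y < a + 2 ^ d")
    case True
    then have "count_list (concat (map (filter (\<lambda>x. x < a + 2 ^ d)) xss)) y = l" using Suc by auto
    then show ?thesis using filter[of "\<lambda>x. x < a + 2 ^ d"] True by metis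
  next
    case False
    then have "count_list (concat (map (filter (\<lambda>x. \<not> x < a + 2 ^ d)) xss)) y = l" using Suc by auto
    then show ?thesis using filter[of "\<lambda>x. \<not> x < a + 2 ^ d"] False by metis
  qed
qed

lemma count_neighbours:
  assumes "\<forall>b\<in>set Ds. distinct b" "y \<noteq> i"
  shows "count_list (neighbours i Ds) y = length (filter (\<lambda>b. i \<in> set b \<and> y \<in> set b) Ds)"
proof -
  have "count_list b y = of_bool (y \<in> set b)" if "distinct b" for b
    using that by (induction b) auto
  with assms show ?thesis
    unfolding neighbours_def by (induction Ds) auto
qed

lemma balanced_at_count:
  assumes "balanced_at l Dss i" "\<forall>b\<in>set (concat Dss). distinct b" "y \<noteq> i" "y < 55"
  shows "length (filter (\<lambda>b. i \<in> set b \<and> y \<in> set b) (concat Dss)) = l"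
proof -
  have "y \<notin> set (concat (map (replicate l) (i # [55..<64])))" using assms(3,4) by auto
  then have "count_list (concat (map (replicate l) (i # [55..<64]))) y = 0"
    by (simp only: count_list_0_iff not_False_eq_True)
  moreover have "count_list (concat (map (replicate l) (i # [55..<64]) @ map (neighbours i) Dss)) y = l"
    using assms(1,4) by (intro uniform_count[of l 6 0]) (auto simp: balanced_at_def)
  moreover have "concat (map (neighbours i) Dss) = neighbours i (concat Dss)"
    by (induction Dss) (simp_all add: neighbours_def)
  ultimately show ?thesis
    using count_neighbours[OF assms(2,3)] by (simp only: concat_append count_list_append add_0)
qed

text \<open>A shift moves \<open>x\<close> to the representative of its copy without changing the
  pair count. Distinctness of the developed blocks as sets turns the list count made by
  \<open>balanced\<close> into a cardinality.\<close>

lemma two_design_develop: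
  assumes "valid_blocks bs" "balanced l bs" "distinct (map set (develop bs))"
  shows "two_design (set ` set (develop bs)) l"
  unfolding two_design_def
proof (intro conjI ballI allI impI)
  let ?F = "set ` set (develop bs)"
  note block = develop_block[OF assms(1)]
  show sub: "B \<subseteq> {..<55}" if "B \<in> ?F" for B using that block(2) by blast
  show "card B = 10" if "B \<in> ?F" for B using that block(3) by blast
  fix x y :: nat assume xy: "x < 55" "y < 55" "x \<noteq> y"
  obtain i j where i: "i \<in> {0, 11, 22, 33, 44}" "shift j i = x" using shift_representative[OF xy(1)] by blast
  have closed: "shift j ` B \<in> ?F" if B: "B \<in> ?F" for B
  proof -
    obtain b k where "b \<in> set bs" "B = shift k ` set b" using B unfolding set_develop by blast
    then have "shift j ` B = shift (j + k) ` set b" by (simp add: image_image shift_shift)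
    with \<open>b \<in> set bs\<close> show ?thesis unfolding set_develop by blast
  qed
  have "shift j ` {..<55} = {..<55}"
    by (rule endo_inj_surj) (use shift_less inj_on_subset[OF inj_shift] in auto)
  then obtain z where z: "z < 55" "shift j z = y" using xy(2) by (metis imageE lessThan_iff)
  have "card {B \<in> ?F. shift j i \<in> B \<and> shift j z \<in> B} = card {B \<in> ?F. i \<in> B \<and> z \<in> B}"
    by (rule pair_count_invariant[OF sub inj_on_subset[OF inj_shift] closed]) (use i(1) z in auto)
  also have "\<dots> = length (filter (\<lambda>b. i \<in> set b \<and> z \<in> set b) (develop bs))"
  proof -
    have "{B \<in> ?F. i \<in> B \<and> z \<in> B} = set (filter (\<lambda>B. i \<in> B \<and> z \<in> B) (map set (develop bs)))" by auto
    then have "card {B \<in> ?F. i \<in> B \<and> z \<in> B} = length (filter (\<lambda>B. i \<in> B \<and> z \<in> B) (map set (develop bs)))"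
      using distinct_card[OF distinct_filter[OF assms(3)]] by metis
    then show ?thesis by (simp add: filter_map comp_def)
  qed
  also have "\<dots> = l"
    unfolding develop_def
  proof (rule balanced_at_count)
    show "balanced_at l (map shifts bs) i" using assms(2) i(1) by (auto simp: balanced_def)
    show "z \<noteq> i" using i z xy(3) by auto
  qed (use block z in \<open>auto simp: develop_def\<close>)
  finally show "card {B \<in> ?F. x \<in> B \<and> y \<in> B} = l" using i(2) z(2) by simp
qed

text \<open>A base 53 number with the two membership flags as leading digit. On actual invariants
  the added 1 avoids the reserved value 0, and the result stays below 2 ^ 14, matching the depth in
  \<open>spread_keys\<close>.\<close>

definition encode :: "bool \<times> bool \<times> int \<times> int \<Rightarrow> nat" where
  "encode = (\<lambda>(p, q, u, v). nat (1 + 53 * (53 * (of_bool p + 2 * of_bool q) + u) + v))"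

text \<open>Reducing modulo 53 at every stage respects the congruences. Four squarings give the 16th
  power, and 34 = 2 + 2 * 16 gives the other exponent.\<close>

lemma key_eq:
  assumes "distinct b"
  shows "key b = (if skew (set b) then encode (invariants (set b)) else 0)"
proof -
  define c where "c = map int (filter (\<lambda>x. x < 53) b)"
  define k s1 s2 s3 s4 where "k = int (length c)" and "s1 = sum_list c mod 53"
    and "s2 = sum_list (map (\<lambda>x. x ^ 2) c) mod 53"
    and "s3 = sum_list (map (\<lambda>x. x ^ 3) c) mod 53" and "s4 = sum_list (map (\<lambda>x. x ^ 4) c) mod 53"
  define m2 m3 m4 where "m2 = (k * s2 - s1 ^ 2) mod 53"
    and "m3 = (k ^ 2 * s3 - 3 * k * s1 * s2 + 2 * s1 ^ 3) mod 53"
    and "m4 = (k ^ 3 * s4 - 4 * k ^ 2 * s1 * s3 + 6 * k * s1 ^ 2 * s2 - 3 * s1 ^ 4) mod 53"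
  define e where "e = sq53 (sq53 (sq53 (sq53 m3)))"
  have psum: "psum j (set b) = sum_list (map (\<lambda>x. x ^ j) c)" for j
  proof -
    have "set b \<inter> {..<53} = set (filter (\<lambda>x. x < 53) b)" by auto
    then show ?thesis
      unfolding psum_def c_def using assms
      by (simp add: sum.distinct_set_conv_list comp_def del: set_filter)
  qed
  have s: "[k = psum 0 (set b)] (mod 53)" "[s1 = psum 1 (set b)] (mod 53)"
    "[s2 = psum 2 (set b)] (mod 53)" "[s3 = psum 3 (set b)] (mod 53)" "[s4 = psum 4 (set b)] (mod 53)"
    unfolding psum k_def s1_def s2_def s3_def s4_def by (simp_all add: cong_def sum_list_triv)
  have m: "[m2 = moment2 (set b)] (mod 53)" "[m3 = moment3 (set b)] (mod 53)" "[m4 = moment4 (set b)] (mod 53)"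
    unfolding m2_def m3_def m4_def moment2_def moment3_def moment4_def cong_mod_left
    by (intro cong_diff cong_add cong_mult cong_pow cong_refl s)+
  have sq: "[sq53 x = y ^ (2 * n)] (mod 53)" if "[x = y ^ n] (mod 53)" for x y n
    using cong_mult[OF that that] by (simp add: sq53_def mult_2 power_add)
  have m3: "[m3 = moment3 (set b) ^ 1] (mod 53)" using m(2) by simp
  have e: "[e = moment3 (set b) ^ 16] (mod 53)"
    unfolding e_def using sq[OF sq[OF sq[OF sq[OF m3]]]] by simp
  have "[m2 * sq53 m3 * sq53 e = moment2 (set b) * moment3 (set b) ^ 2 * moment3 (set b) ^ 32] (mod 53)"
    using sq[OF m3] sq[OF e] by (intro cong_mult m(1)) simp_all
  then have u: "m2 * sq53 m3 * sq53 e mod 53 = moment2 (set b) * moment3 (set b) ^ 34 mod 53"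
    by (simp add: cong_def mult.assoc flip: power_add)
  have v: "m4 * e mod 53 = moment4 (set b) * moment3 (set b) ^ 16 mod 53"
    using cong_mult[OF m(3) e] by (simp add: cong_def)
  have "m3 mod 53 = m3" by (simp add: m3_def)
  then have "m3 = 0 \<longleftrightarrow> \<not> skew (set b)"
    using m(2) by (simp add: skew_def cong_def dvd_eq_mod_eq_0)
  moreover have "key b = (if m3 = 0 then 0
      else nat (1 + 53 * (53 * (of_bool (53 \<in> set b) + 2 * of_bool (54 \<in> set b))
        + m2 * sq53 m3 * sq53 e mod 53) + m4 * e mod 53))"
    unfolding key_def Let_def c_def[symmetric]
    unfolding k_def[symmetric] s1_def[symmetric] s2_def[symmetric] s3_def[symmetric] s4_def[symmetric]
    unfolding m2_def[symmetric] m3_def[symmetric] m4_def[symmetric]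
    unfolding e_def[symmetric] by (rule refl)
  ultimately show ?thesis
    by (simp add: encode_def invariants_def u v)
qed

lemma spread_imp_distinct: "spread d xs \<Longrightarrow> distinct xs"
proof (induction d arbitrary: xs)
  case 0
  then show ?case by (cases xs) auto
next
  case (Suc d)
  have split: "distinct xs" if "distinct (map f (filter P xs))" "distinct (map f (filter (\<lambda>x. \<not> P x) xs))"
    for f :: "nat \<Rightarrow> nat" and P
    using that by (induction xs) (auto split: if_splits)
  show ?case
  proof (cases "tl xs = []")
    case True
    then show ?thesis by (cases xs) auto
  next
    case False
    show ?thesis
      by (rule split[of "\<lambda>x. x div 2" even]; rule Suc.IH; use Suc.prems False in simp)
  qed
qed

text \<open>Transfers distinctness from a computed fingerprint \<open>f\<close> to the objects
  \<open>g\<close> that determine it.\<close>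

lemma distinct_map_mono:
  assumes "distinct (map f xs)" "\<And>x y. x \<in> set xs \<Longrightarrow> y \<in> set xs \<Longrightarrow> g x = g y \<Longrightarrow> f x = f y"
  shows "distinct (map g xs)"
  using assms unfolding distinct_map inj_on_def by blast

section \<open>The explicit designs\<close>

text \<open>
  The design with \<open>\<lambda> = 4\<close> is an orbit of PSL(2,11) acting on its 55 involutions, the one
  with \<open>\<lambda> = 5\<close> comes from three base blocks over \<open>\<int>\<^sub>5 \<times> \<int>\<^sub>1\<^sub>1\<close>, and the one with \<open>\<lambda> = 11\<close> is a union of
  orbits of PSL(2,11) acting on its 55 Klein four-subgroups. The points are relabelled so that an
  automorphism of order 11 becomes \<open>shift 1\<close> and, for the first two, all blocks are skew with distinct
  invariants.
\<close>

definition base4 :: "nat list list" where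
  "base4 =
   [[0, 1, 3, 6, 7, 12, 14, 25, 42, 45], [0, 1, 8, 19, 23, 28, 30, 36, 39, 54],
    [0, 1, 9, 14, 20, 24, 34, 39, 41, 53], [0, 2, 11, 13, 24, 31, 33, 43, 44, 46],
    [0, 2, 21, 30, 42, 44, 45, 49, 50, 52], [0, 4, 13, 20, 24, 27, 33, 42, 44, 48],
    [0, 5, 15, 26, 29, 31, 38, 47, 49, 50], [0, 11, 15, 16, 19, 21, 23, 30, 43, 54],
    [0, 14, 15, 18, 28, 33, 34, 38, 48, 54], [0, 15, 22, 23, 28, 31, 32, 33, 34, 51],
    [0, 16, 17, 19, 22, 32, 41, 49, 52, 53], [0, 21, 29, 35, 37, 39, 40, 43, 51, 53]]"

definition base5 :: "nat list list" where
  "base5 =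
   [[0, 1, 2, 6, 8, 9, 16, 29, 34, 54], [0, 1, 12, 19, 24, 26, 34, 36, 48, 50],
    [0, 1, 16, 17, 31, 32, 37, 40, 49, 53], [0, 2, 13, 21, 24, 28, 34, 41, 44, 51],
    [0, 2, 14, 16, 23, 25, 33, 39, 45, 53], [0, 3, 13, 14, 24, 29, 38, 43, 45, 50],
    [0, 3, 15, 18, 28, 31, 39, 41, 53, 54], [0, 4, 13, 20, 25, 32, 33, 43, 44, 49],
    [0, 4, 15, 21, 23, 26, 39, 42, 48, 51], [0, 5, 14, 19, 25, 30, 34, 38, 44, 46],
    [0, 5, 16, 18, 22, 23, 40, 41, 51, 52], [0, 11, 13, 17, 18, 19, 21, 27, 35, 47],
    [0, 11, 25, 27, 28, 30, 31, 32, 35, 47], [0, 11, 27, 33, 35, 36, 38, 39, 40, 47],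
    [0, 11, 27, 35, 45, 47, 48, 50, 51, 52]]"

definition base11 :: "nat list list" where
  "base11 =
   [[0, 1, 2, 9, 11, 17, 18, 35, 42, 48], [0, 1, 3, 6, 18, 24, 41, 45, 52, 53],
    [0, 1, 3, 21, 22, 25, 26, 27, 31, 44], [0, 1, 4, 5, 9, 19, 38, 44, 46, 54],
    [0, 1, 4, 16, 28, 29, 30, 32, 37, 47], [0, 1, 7, 19, 31, 33, 42, 44, 49, 51],
    [0, 1, 12, 13, 23, 27, 34, 37, 39, 51], [0, 1, 13, 21, 26, 30, 33, 34, 49, 50],
    [0, 1, 14, 22, 24, 25, 36, 40, 50, 51], [0, 2, 6, 11, 13, 15, 24, 33, 36, 48],
    [0, 2, 6, 13, 19, 26, 30, 32, 37, 47], [0, 2, 7, 26, 33, 40, 42, 43, 50, 54],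
    [0, 2, 8, 13, 16, 25, 30, 41, 53, 54], [0, 2, 12, 18, 22, 25, 36, 38, 44, 53],
    [0, 2, 14, 17, 18, 24, 36, 41, 43, 52], [0, 3, 6, 15, 31, 34, 36, 40, 45, 53],
    [0, 3, 13, 17, 18, 25, 26, 27, 43, 54], [0, 4, 11, 12, 14, 17, 23, 29, 31, 40],
    [0, 4, 15, 18, 23, 33, 34, 44, 50, 53], [0, 5, 15, 19, 25, 27, 35, 41, 45, 50],
    [0, 11, 13, 14, 20, 21, 25, 40, 41, 43], [0, 12, 16, 19, 21, 32, 37, 38, 41, 47],
    [0, 13, 15, 16, 32, 37, 46, 47, 49, 52], [0, 13, 17, 19, 24, 31, 38, 39, 50, 54],
    [0, 15, 17, 26, 29, 31, 42, 46, 51, 54], [0, 16, 20, 21, 25, 28, 37, 47, 51, 52],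
    [0, 16, 23, 29, 32, 37, 41, 42, 46, 48], [0, 16, 25, 26, 32, 36, 37, 39, 42, 47],
    [0, 17, 22, 23, 35, 38, 43, 46, 48, 52], [0, 20, 21, 22, 26, 29, 32, 45, 49, 51],
    [0, 23, 30, 31, 34, 35, 39, 41, 42, 53], [11, 13, 19, 27, 35, 44, 47, 48, 52, 54],
    [11, 27, 32, 36, 40, 42, 44, 51, 53, 54]]"

lemma valid_bases: "valid_blocks base4" "valid_blocks base5" "valid_blocks base11"
  by code_simp+

lemma balanced_base4: "balanced 4 base4"
  by code_simp

lemma balanced_base5: "balanced 5 base5"
  by code_simp

lemma balanced_base11: "balanced 11 base11"
  by code_simp

text \<open>The prepended 0 makes the same test exclude the key 0, so that it also certifies
  skewness.\<close>

lemma spread_keys: "spread 14 (0 # map key (develop base4 @ develop base5))"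
  by code_simp

lemma spread_cube_sums: "spread 20 (map cube_sum (develop base11))"
  by code_simp

lemma design_11: "two_design (set ` set (develop base11)) 11"
proof (rule two_design_develop[OF valid_bases(3) balanced_base11])
  have "cube_sum b = (\<Sum>x\<in>set b. x ^ 3)" if "b \<in> set (develop base11)" for b
    using develop_block(1)[OF valid_bases(3) that] by (simp add: cube_sum_def sum.distinct_set_conv_list)
  then show "distinct (map set (develop base11))"
    by (intro distinct_map_mono[OF spread_imp_distinct[OF spread_cube_sums]]) simp
qed

text \<open>The key is a function of the invariants of a skew block, so pairwise different keys
  separate the invariants, the blocks within each design and the two designs from each
  other.\<close>

lemma designs_4_5:
  fixes D4 D5
  defines "D4 \<equiv> set ` set (develop base4)" and "D5 \<equiv> set ` set (develop base5)"
  shows "two_design D4 4" "two_design D5 5" "D4 \<inter> D5 = {}" "card (D4 \<union> D5) \<le> 300"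
    and "\<And>B. B \<in> D4 \<union> D5 \<Longrightarrow> skew B" and "inj_on invariants (D4 \<union> D5)"
proof -
  let ?Ds = "develop base4 @ develop base5"
  have sets: "D4 \<union> D5 = set ` set ?Ds" unfolding D4_def D5_def by auto
  have dist: "distinct b" if "b \<in> set ?Ds" for b
    using that develop_block(1)[OF valid_bases(1)] develop_block(1)[OF valid_bases(2)] by auto
  have "distinct (0 # map key ?Ds)" using spread_keys by (rule spread_imp_distinct)
  then have keys: "distinct (map key ?Ds)" and "0 \<notin> key ` set ?Ds"
    unfolding distinct.simps set_map by blast+
  then have pos: "key b \<noteq> 0" if "b \<in> set ?Ds" for b using that by (metis imageI)
  have sk: "skew (set b)" if "b \<in> set ?Ds" for b
    using pos[OF that] key_eq[OF dist[OF that]] by (auto split: if_splits)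
  then show "\<And>B. B \<in> D4 \<union> D5 \<Longrightarrow> skew B" unfolding sets by auto
  have inv: "key b = key c" if "b \<in> set ?Ds" "c \<in> set ?Ds" "invariants (set b) = invariants (set c)" for b c
    using that sk dist by (simp add: key_eq)
  have inj: "inj_on key (set ?Ds)" using keys unfolding distinct_map by blast
  show "inj_on invariants (D4 \<union> D5)"
    unfolding sets
  proof (rule inj_onI)
    fix B C assume BC: "B \<in> set ` set ?Ds" "C \<in> set ` set ?Ds" "invariants B = invariants C"
    then obtain b c where bc: "b \<in> set ?Ds" "B = set b" "c \<in> set ?Ds" "C = set c" by blast
    then have "key b = key c" using BC(3) inv by blast
    then show "B = C" using inj_onD[OF inj] bc by blast
  qed
  have ds: "distinct (map set ?Ds)"
    by (rule distinct_map_mono[OF keys]) (rule inv; simp)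
  then show "two_design D4 4" "two_design D5 5" "D4 \<inter> D5 = {}"
    unfolding D4_def D5_def
    using two_design_develop[OF valid_bases(1) balanced_base4] two_design_develop[OF valid_bases(2) balanced_base5]
    by auto
  have "card (D4 \<union> D5) \<le> length ?Ds"
    unfolding sets using card_image_le[of "set ?Ds" set] card_length[of ?Ds] by simp
  also have "length ?Ds = 297"
    by (simp add: develop_def shifts_def length_concat comp_def base4_def base5_def)
  finally show "card (D4 \<union> D5) \<le> 300" by simp
qed

section \<open>Assembling all values of lambda\<close>

theorem theorem2:
  fixes M :: nat
  assumes "M = 443161355"
  shows "real M = 1 / 2 * real (53 choose 8) \<and>
    (\<forall>m \<in> {4, 5} \<union> {8..M}. \<exists>(P :: nat set) B. simple_design 2 55 10 m P B)"
proof (intro conjI ballI)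
  have "53 choose 8 = (886322710::nat)" by code_simp
  then show "real M = 1 / 2 * real (53 choose 8)" using assms by simp
next
  fix m assume m: "m \<in> {4, 5} \<union> {8..M}"
  have combine: "\<exists>F. two_design F m" if "m = 4 * i + 5 * j + 2756 * q" "i \<le> 2756" "j \<le> 2756" "q \<le> 160799"
    for i j q
    using exists_design[OF designs_4_5 that(2-4)] that(1) by blast
  consider "m = 11" | "m \<in> {4, 5, 8, 9, 10}" | "12 \<le> m" "m \<le> M" using m by fastforce
  then have "\<exists>F. two_design F m"
  proof cases
    case 1
    then show ?thesis using design_11 by blast
  next
    case 2
    then show ?thesis
      using combine[of 1 0 0] combine[of 0 1 0] combine[of 2 0 0] combine[of 1 1 0] combine[of 0 2 0] by auto
  next
    case 3
    \<comment> \<open>The offset 12 ensures r div 4 >= 3 >= r mod 4, so that r = 4 (r div 4 - r mod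
      4) + 5 (r mod 4) has natural coefficients; r < 2768 keeps them within the 2756 available
      translates.\<close>
    define q r where "q = (m - 12) div 2756" and "r = (m - 12) mod 2756 + 12"
    have mqr: "m = 2756 * q + r" using 3(1) unfolding q_def r_def by simp
    have r: "12 \<le> r" "r < 2768" unfolding r_def by simp_all
    have "12 div 4 \<le> r div 4" using r(1) by (rule div_le_mono)
    moreover have "r mod 4 < 4" by simp
    ultimately have "r mod 4 \<le> r div 4" by simp
    then have "r = 4 * (r div 4 - r mod 4) + 5 * (r mod 4)"
      using mult_div_mod_eq[of 4 r] by linarith
    moreover have "q \<le> 160799" using 3 assms unfolding q_def by simp
    ultimately show ?thesis
      by (intro combine[of "r div 4 - r mod 4" "r mod 4" q]) (use mqr r(2) \<open>r mod 4 < 4\<close> in linarith)+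
  qed
  then show "\<exists>(P :: nat set) B. simple_design 2 55 10 m P B"
    using two_design_imp_simple_design by blast
qed

end
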